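(* Let $T^0,T^t,S_t,\lambda,E,u_i^t,\tilde u_i^t,\widetilde E_t,D_t\lambda_i,P_t^e,F_{P_t^e}$ be as defined in the context. Suppose $\dim\widetilde E_t=\dim E$. Let $\{\tilde\phi_i\}_{i=n}^{N}$ be a basis of $\widetilde E_t$ and $\{\phi_i\}_{i=n}^{N}$ a basis of $E$, and let $M_t,N_t$ be the square matrices, with rows and columns indexed by $n,\dots,N$, whose entries are $$(M_t)_{ji}:=F_{P_t^e}(\tilde\phi_i,\phi_j),\qquad (N_t)_{ji}:=(\tilde\phi_i,\phi_j)_{T^0}\qquad(i,j=n,\dots,N).$$ Then, for each $i=n,\dots,N$, the difference quotient $D_t\lambda_i$ is the $(i-n+1)$-th eigenvalue of the matrix eigenvalue problem $$M_t\sigma=\mu N_t\sigma .$$ Moreover, for the eigenfunctions $u_i^t$ ($i=n,\dots,N$) over the perturbed domain $T^t$ we have $$\tilde u_i^t=u_i^t\circ S_t=s_{ni}\tilde\phi_n+\cdots+s_{Ni}\tilde\phi_N\in\widetilde E_t\qquad(i=n,\dots,N),$$ where $\sigma_i:=(s_{ni},\dots,s_{Ni})^\intercal$ is an eigenvector corresponding to the $(i-n+1)$-th eigenvalue of $M_t\sigma=\mu N_t\sigma$.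
   Context: For $p=(x,y)\in\mathbb{R}^2$, $T^p$ is the triangular domain with vertices $(0,0),(1,0),(x,y)$ (so $y\neq0$), and $\lambda_1^p<\lambda_2^p\le\lambda_3^p\le\cdots$ are its Dirichlet Laplacian eigenvalues counted with multiplicity (weak form: $(\nabla u,\nabla v)_{T^p}=\lambda(u,v)_{T^p}$ for all $v\in H^1_0(T^p)$, where $(\cdot,\cdot)_T$ is the $L^2(T)$ or $(L^2(T))^2$ inner product). Fix indices $n\le N$ with $\lambda_n^p=\cdots=\lambda_N^p=:\lambda$, and let $E\subset H^1_0(T^p)$ be the eigenspace corresponding to $\lambda$. For $t>0$ and a unit vector $e\in\mathbb{R}^2$, let $p_t:=p+te=:(\tilde x,\tilde y)$ (again with $T^{p_t}$ a triangle, so $\tilde y\ne0$), $T^0:=T^p$, $T^t:=T^{p_t}$, $\lambda_i^t:=\lambda_i^{p_t}$. Let $u_n^t,\dots,u_N^t$ be linearly independent Dirichlet eigenfunctions on $T^t$ corresponding to $\lambda_n^t,\dots,\lambda_N^t$ respectively. Let $S_t=\begin{pmatrix}1&(\tilde x-x)/y\\0&\tilde y/y\end{pmatrix}$, the linear map taking $T^0$ to $T^t$; $\tilde u_i^t:=u_i^t\circ S_t\in H^1_0(T^0)$; $\widetilde E_t:=\mathrm{span}\{\tilde u_n^t,\dots,\tilde u_N^t\}$. The difference quotients are $D_t\lambda_i:=(\lambda_i^t-\lambda)/t$ for $i=n,\dots,N$. Let $P_t^e:=(S_t^{-1}S_t^{-\intercal}-I)/t$, a symmetric $2\times2$ matrix,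 and $F_{P_t^e}(u,v):=(P_t^e\nabla u,\nabla v)_{T^0}$ for $u,v\in H^1_0(T^0)$. Eigenvalues of the matrix problem $M_t\sigma=\mu N_t\sigma$ are numbered in nondecreasing order, counted with multiplicity.
   Formalization: That D_tλ_i is the (i-n+1)-th eigenvalue is asserted only when det(M_t - zN_t) is not identically zero; otherwise (N_t singular) every μ is an eigenvalue and the numbering has no meaning. The eigenvector and expansion claims are kept without this condition. *)

theory Defs
  imports "HOL-Analysis.Analysis" "Jordan_Normal_Form.Determinant"
begin

(* "$" is reserved for the components of real^2; vectors and matrices whose size
   depends on the index range are those of Jordan_Normal_Form. *)
no_notation Matrix.vec_index (infixl \<open>$\<close> 100)

section \<open>Sobolev spaces on subsets of the plane\<close>

text \<open>Functions on \<open>\<Omega>\<close> are represented by functions on the whole plane; only their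
  values on \<open>\<Omega>\<close>, up to Lebesgue null sets, matter.\<close>

definition L2 :: "(real^2) set \<Rightarrow> (real^2 \<Rightarrow> 'b::euclidean_space) set" where
  "L2 \<Omega> = {f. f \<in> borel_measurable (lebesgue_on \<Omega>) \<and>
               integrable (lebesgue_on \<Omega>) (\<lambda>x. (norm (f x))\<^sup>2)}"

definition l2_inner ::
  "(real^2) set \<Rightarrow> (real^2 \<Rightarrow> 'b::euclidean_space) \<Rightarrow> (real^2 \<Rightarrow> 'b) \<Rightarrow> real" where
  "l2_inner \<Omega> f g = (\<integral>x. f x \<bullet> g x \<partial>lebesgue_on \<Omega>)"

definition l2_norm :: "(real^2) set \<Rightarrow> (real^2 \<Rightarrow> 'b::euclidean_space) \<Rightarrow> real" where
  "l2_norm \<Omega> f = sqrt (l2_inner \<Omega> f f)"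

fun C_k :: "nat \<Rightarrow> (real^2 \<Rightarrow> real) \<Rightarrow> bool" where
  "C_k 0 f \<longleftrightarrow> continuous_on UNIV f"
| "C_k (Suc k) f \<longleftrightarrow> (\<forall>x. f differentiable (at x)) \<and>
     (\<forall>v. C_k k (\<lambda>x. frechet_derivative f (at x) v))"

definition test_functions :: "(real^2) set \<Rightarrow> (real^2 \<Rightarrow> real) set" where
  "test_functions \<Omega> = {f. (\<forall>k. C_k k f) \<and>
     compact (closure {x. f x \<noteq> 0}) \<and> closure {x. f x \<noteq> 0} \<subseteq> \<Omega>}"

definition grad :: "(real^2 \<Rightarrow> real) \<Rightarrow> real^2 \<Rightarrow> real^2" where
  "grad f x = (\<chi> i. frechet_derivative f (at x) (axis i 1))"

definition is_weak_grad :: "(real^2) set \<Rightarrow> (real^2 \<Rightarrow> real) \<Rightarrow> (real^2 \<Rightarrow> real^2) \<Rightarrow> bool" where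
  "is_weak_grad \<Omega> u g \<longleftrightarrow> g \<in> L2 \<Omega> \<and>
     (\<forall>\<psi>\<in>test_functions \<Omega>. \<forall>i.
        (\<integral>x. u x * grad \<psi> x $ i \<partial>lebesgue_on \<Omega>) = - (\<integral>x. g x $ i * \<psi> x \<partial>lebesgue_on \<Omega>))"

text \<open>For open \<open>\<Omega>\<close> a weak gradient is unique up to null sets; a representative is chosen.\<close>

definition weak_grad :: "(real^2) set \<Rightarrow> (real^2 \<Rightarrow> real) \<Rightarrow> real^2 \<Rightarrow> real^2" where
  "weak_grad \<Omega> u = (SOME g. is_weak_grad \<Omega> u g)"

definition H1 :: "(real^2) set \<Rightarrow> (real^2 \<Rightarrow> real) set" where
  "H1 \<Omega> = {u \<in> L2 \<Omega>. \<exists>g. is_weak_grad \<Omega> u g}"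

definition H10 :: "(real^2) set \<Rightarrow> (real^2 \<Rightarrow> real) set" where
  "H10 \<Omega> = {u \<in> H1 \<Omega>. \<exists>\<phi>::nat \<Rightarrow> real^2 \<Rightarrow> real. (\<forall>k. \<phi> k \<in> test_functions \<Omega>) \<and>
     (\<lambda>k. l2_norm \<Omega> (\<lambda>x. \<phi> k x - u x)) \<longlonglongrightarrow> 0 \<and>
     (\<lambda>k. l2_norm \<Omega> (\<lambda>x. grad (\<phi> k) x - weak_grad \<Omega> u x)) \<longlonglongrightarrow> 0}"

section \<open>Linear algebra modulo null sets\<close>

definition lin_indep_ae :: "(real^2) set \<Rightarrow> nat set \<Rightarrow> (nat \<Rightarrow> real^2 \<Rightarrow> real) \<Rightarrow> bool" where
  "lin_indep_ae \<Omega> I w \<longleftrightarrow>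
     (\<forall>c. (AE z in lebesgue_on \<Omega>. (\<Sum>i\<in>I. c i * w i z) = 0) \<longrightarrow> (\<forall>i\<in>I. c i = 0))"

definition span_ae :: "(real^2) set \<Rightarrow> nat set \<Rightarrow> (nat \<Rightarrow> real^2 \<Rightarrow> real) \<Rightarrow> (real^2 \<Rightarrow> real) set" where
  "span_ae \<Omega> I w = {v. \<exists>c. AE z in lebesgue_on \<Omega>. v z = (\<Sum>i\<in>I. c i * w i z)}"

definition is_basis_ae ::
  "(real^2) set \<Rightarrow> (real^2 \<Rightarrow> real) set \<Rightarrow> nat set \<Rightarrow> (nat \<Rightarrow> real^2 \<Rightarrow> real) \<Rightarrow> bool" where
  "is_basis_ae \<Omega> V I w \<longleftrightarrow> lin_indep_ae \<Omega> I w \<and> span_ae \<Omega> I w = V"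

definition has_dim_ae :: "(real^2) set \<Rightarrow> (real^2 \<Rightarrow> real) set \<Rightarrow> nat \<Rightarrow> bool" where
  "has_dim_ae \<Omega> V m \<longleftrightarrow> (\<exists>w. is_basis_ae \<Omega> V {..<m} w)"

section \<open>Dirichlet eigenvalues\<close>

definition eigenspace :: "(real^2) set \<Rightarrow> real \<Rightarrow> (real^2 \<Rightarrow> real) set" where
  "eigenspace \<Omega> \<mu> = {u \<in> H10 \<Omega>. \<forall>v\<in>H10 \<Omega>.
     l2_inner \<Omega> (weak_grad \<Omega> u) (weak_grad \<Omega> v) = \<mu> * l2_inner \<Omega> u v}"

definition is_eigenfunction :: "(real^2) set \<Rightarrow> real \<Rightarrow> (real^2 \<Rightarrow> real) \<Rightarrow> bool" where
  "is_eigenfunction \<Omega> \<mu> u \<longleftrightarrow> u \<in> eigenspace \<Omega> \<mu> \<and> \<not> (AE z in lebesgue_on \<Omega>. u z = 0)"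

text \<open>The values \<open>lam 1 \<le> lam 2 \<le> \<dots>\<close> (\<open>lam 0\<close> is irrelevant) are the eigenvalues counted
  with multiplicity: every real \<open>\<mu>\<close> is listed as often as its eigenspace has dimensions, so
  not at all if it is not an eigenvalue.\<close>

definition dirichlet_eigenvalues :: "(real^2) set \<Rightarrow> (nat \<Rightarrow> real) \<Rightarrow> bool" where
  "dirichlet_eigenvalues \<Omega> lam \<longleftrightarrow>
     (\<forall>i j. 1 \<le> i \<longrightarrow> i \<le> j \<longrightarrow> lam i \<le> lam j) \<and>
     (\<forall>\<mu>. finite {k. 1 \<le> k \<and> lam k = \<mu>} \<and>
          has_dim_ae \<Omega> (eigenspace \<Omega> \<mu>) (card {k. 1 \<le> k \<and> lam k = \<mu>}))"

section \<open>Triangles\<close>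

definition tri :: "real^2 \<Rightarrow> (real^2) set" where
  "tri p = interior (convex hull {vector [0, 0], vector [1, 0], p})"

definition tri_map :: "real^2 \<Rightarrow> real^2 \<Rightarrow> real^2^2" where
  "tri_map p q = vector [vector [1, (q$1 - p$1) / p$2], vector [0, q$2 / p$2]]"

definition P_mat :: "real \<Rightarrow> real^2^2 \<Rightarrow> real^2^2" where
  "P_mat t S = (1 / t) *\<^sub>R (matrix_inv S ** Finite_Cartesian_Product.transpose (matrix_inv S)
                          - Finite_Cartesian_Product.mat 1)"

definition F_form ::
  "(real^2) set \<Rightarrow> real^2^2 \<Rightarrow> (real^2 \<Rightarrow> real) \<Rightarrow> (real^2 \<Rightarrow> real) \<Rightarrow> real" where
  "F_form \<Omega> P u v = l2_inner \<Omega> (\<lambda>z. P *v weak_grad \<Omega> u z) (weak_grad \<Omega> v)"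

section \<open>The matrix eigenvalue problem \<open>M \<sigma> = \<mu> N \<sigma>\<close>\<close>

definition pencil_eigenvector ::
  "real Matrix.mat \<Rightarrow> real Matrix.mat \<Rightarrow> real \<Rightarrow> real Matrix.vec \<Rightarrow> bool" where
  "pencil_eigenvector M N \<mu> \<sigma> \<longleftrightarrow> \<sigma> \<in> carrier_vec (dim_col M) \<and> \<sigma> \<noteq> 0\<^sub>v (dim_col M) \<and>
     M *\<^sub>v \<sigma> = \<mu> \<cdot>\<^sub>v (N *\<^sub>v \<sigma>)"

text \<open>The polynomial \<open>det (M - z N)\<close> in \<open>z\<close>.\<close>

definition pencil_poly :: "real Matrix.mat \<Rightarrow> real Matrix.mat \<Rightarrow> real poly" where
  "pencil_poly M N = Determinant.det
     (map_mat (\<lambda>a. [:a:]) M - [:0, 1:] \<cdot>\<^sub>m map_mat (\<lambda>a. [:a:]) N)"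

text \<open>If \<open>pencil_poly M N = 0\<close> (then \<open>N\<close> is singular), every real number \<open>\<mu>\<close> admits some
  \<open>\<sigma> \<noteq> 0\<close> with \<open>M \<sigma> = \<mu> N \<sigma>\<close>, and there is no \<open>k\<close>-th eigenvalue.\<close>

definition regular_pencil :: "real Matrix.mat \<Rightarrow> real Matrix.mat \<Rightarrow> bool" where
  "regular_pencil M N \<longleftrightarrow> pencil_poly M N \<noteq> 0"

text \<open>The real eigenvalues of a regular pencil in nondecreasing order, counted with
  multiplicity as roots of \<open>pencil_poly\<close>. If the list is as long as the matrices are wide,
  then there are no non-real or infinite eigenvalues.\<close>

definition pencil_eigenvalues :: "real Matrix.mat \<Rightarrow> real Matrix.mat \<Rightarrow> real list" where
  "pencil_eigenvalues M N = sorted_list_of_multiset (proots (pencil_poly M N))"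

text \<open>The eigenvalue number \<open>k\<close>, with numbering from 1.\<close>

definition is_kth_pencil_eigenvalue ::
  "real Matrix.mat \<Rightarrow> real Matrix.mat \<Rightarrow> nat \<Rightarrow> real \<Rightarrow> bool" where
  "is_kth_pencil_eigenvalue M N k \<mu> \<longleftrightarrow>
     1 \<le> k \<and> k \<le> length (pencil_eigenvalues M N) \<and> pencil_eigenvalues M N ! (k - 1) = \<mu>"

end

theory Submission
  imports Defs
begin

text \<open>Pulling the weak form of the eigenvalue problem on \<open>Tt\<close> back along \<open>S\<close> cancels the Jacobian
  determinant and gives \<open>(S\<^sup>-\<^sup>1 S\<^sup>-\<^sup>T \<nabla>ut i, \<nabla>v) = lamt i (ut i, v)\<close> for all \<open>v\<close> in \<open>H10 T0\<close>. For \<open>v\<close>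
  in \<open>E\<close>, subtracting the symmetric identity \<open>(\<nabla>ut i, \<nabla>v) = lam (ut i, v)\<close> and dividing by \<open>t\<close> leaves
  \<open>F_form T0 P (ut i) v = D i (ut i, v)\<close>. In coordinates \<open>X\<close> of the \<open>ut i\<close> with respect to the basis
  \<open>\<phi>t\<close> this reads \<open>Mt X = Nt X diag(D)\<close> with \<open>X\<close> invertible, so \<open>det (Mt - z Nt)\<close> is
  \<open>det Nt\<close> times the product of the \<open>D i - z\<close>.

  Since \<open>weak_grad\<close> is only a chosen representative, its linearity and its behaviour under
  linear maps rest on the almost everywhere uniqueness of weak gradients.\<close>

text \<open>The bases \<open>\<phi>t\<close> and \<open>\<phi>\<close> span different spaces in
  general, so \<open>Nt\<close> is not a Gram matrix: it need not be symmetric and may be singular.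
  Regularity of the pencil says precisely that this factor is nonzero. The numbering then follows
  because, for \<open>t > 0\<close>, the \<open>D i\<close> inherit the order of the
  \<open>lamt i\<close>.

  The equation for \<open>u i\<close> lives on \<open>Tt\<close>, so an element of \<open>E\<close>
  can serve as its test function only after transport by the inverse of \<open>S\<close>; conversely
  \<open>ut i\<close> must be admissible in the equation on \<open>T0\<close>. Hence
  \<open>H10\<close> has to be carried along linear maps in both directions. Uniqueness of weak
  gradients comes down to having enough test functions, which are built from
  \<open>exp (- (c / x))\<close>.\<close>

no_notation Matrix.scalar_prod (infix \<open>\<bullet>\<close> 70)

section \<open>Test functions\<close>

text \<open>\<open>C_k\<close> refers to \<open>frechet_derivative\<close>, a chosen derivative.
  Uniqueness of derivatives lets an explicit formula \<open>f'\<close> take its place, so later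
  inductions only have to supply such a formula.\<close>

lemma C_k_SucI:
  assumes "\<And>x. (f has_derivative f' x) (at x)" and "\<And>v. C_k k (\<lambda>x. f' x v)"
  shows "C_k (Suc k) f"
proof -
  have "frechet_derivative f (at x) = f' x" for x
    using frechet_derivative_at[OF assms(1)] by simp
  then show ?thesis
    using assms by (auto simp: differentiable_def)
qed

lemma C_k_SucD:
  assumes "C_k (Suc k) f"
  shows "(f has_derivative frechet_derivative f (at x)) (at x)"
    and "C_k k (\<lambda>x. frechet_derivative f (at x) v)"
  using assms by (auto simp: frechet_derivative_works)

lemma C_k_Suc_imp: "C_k (Suc k) f \<Longrightarrow> C_k k f"
proof (induction k arbitrary: f)
  case 0
  then show ?case
    by (auto intro!: differentiable_imp_continuous_on simp: differentiable_on_def)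
next
  case (Suc k)
  then show ?case
    using C_k.simps(2) by blast
qed

lemma C_k_continuous: "C_k k f \<Longrightarrow> continuous_on UNIV f"
  by (induction k) (simp, blast dest: C_k_Suc_imp)

lemma C_k_const: "C_k k (\<lambda>x. c)"
proof (induction k arbitrary: c)
  case (Suc k)
  show ?case
    by (rule C_k_SucI[where f' = "\<lambda>_ _. 0"]) (auto intro: Suc)
qed simp

lemma C_k_add: "C_k k f \<Longrightarrow> C_k k g \<Longrightarrow> C_k k (\<lambda>x. f x + g x)"
proof (induction k arbitrary: f g)
  case (Suc k)
  show ?case
    by (rule C_k_SucI[OF has_derivative_add[OF C_k_SucD(1)[OF Suc.prems(1)] C_k_SucD(1)[OF Suc.prems(2)]]])
      (intro Suc.IH C_k_SucD Suc.prems)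
qed (auto intro: continuous_intros)

lemma C_k_mult: "C_k k f \<Longrightarrow> C_k k g \<Longrightarrow> C_k k (\<lambda>x. f x * g x)"
proof (induction k arbitrary: f g)
  case (Suc k)
  \<comment> \<open>Each term of the product rule leaves one factor undifferentiated, so
    \<open>f\<close> and \<open>g\<close> themselves are also required at the lower order
    \<open>k\<close>; hence \<open>C_k_Suc_imp\<close>.\<close>
  show ?case
    by (rule C_k_SucI[OF has_derivative_mult[OF C_k_SucD(1)[OF Suc.prems(1)] C_k_SucD(1)[OF Suc.prems(2)]]])
      (intro C_k_add Suc.IH C_k_SucD Suc.prems C_k_Suc_imp)
qed (auto intro: continuous_intros)

lemma C_k_prod: "finite I \<Longrightarrow> (\<And>i. i \<in> I \<Longrightarrow> C_k k (f i)) \<Longrightarrow> C_k k (\<lambda>x. \<Prod>i\<in>I. f i x)"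
  by (induction I rule: finite_induct) (auto intro: C_k_const C_k_mult)

text \<open>By the chain rule the derivative in direction \<open>v\<close> is the derivative of
  \<open>f\<close> in the fixed direction \<open>A v\<close>, again composed with \<open>A\<close>,
  so the induction closes.\<close>

lemma C_k_compose_linear:
  assumes "linear A"
  shows "C_k k f \<Longrightarrow> C_k k (\<lambda>x. f (A x))"
proof (induction k arbitrary: f)
  case 0
  then show ?case
    using linear_continuous_on[of A UNIV] assms
    by (auto intro: continuous_on_compose2 simp: linear_conv_bounded_linear)
next
  case (Suc k)
  have "(A has_derivative A) (at x)" for x
    using assms by (simp add: linear_imp_has_derivative)
  then have "((\<lambda>x. f (A x)) has_derivative (\<lambda>v. frechet_derivative f (at (A x)) (A v))) (at x)" for x
    using has_derivative_compose[OF _ C_k_SucD(1)[OF Suc.prems]] by blast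
  then show ?case
    by (rule C_k_SucI) (intro Suc.IH C_k_SucD(2)[OF Suc.prems])
qed

text \<open>The factors \<open>x ^ m\<close> make this family closed under differentiation.\<close>

definition flat :: "nat \<Rightarrow> real \<Rightarrow> real \<Rightarrow> real" where
  "flat m c x = (if x \<le> 0 then 0 else exp (- (c / x)) / x ^ m)"

text \<open>With \<open>y = c / x\<close> the quotient is a constant multiple of
  \<open>y ^ Suc m / exp y\<close>, and \<open>y\<close> tends to infinity.\<close>

lemma flat_quotient_tendsto_0:
  assumes "c > 0"
  shows "((\<lambda>x. flat m c x / x) \<longlongrightarrow> 0) (at_right 0)"
proof -
  have "LIM x at_right (0::real). c / x :> at_top"
    using assms by (intro filterlim_tendsto_pos_mult_at_top[where f = "\<lambda>_. c" and g = "\<lambda>x. 1 / x", simplified])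
      (auto simp: filterlim_inverse_at_top_right simp flip: inverse_eq_divide)
  then have "((\<lambda>x. (c / x) ^ Suc m / exp (c / x)) \<longlongrightarrow> 0) (at_right 0)"
    by (rule filterlim_compose[OF tendsto_power_div_exp_0])
  then have "((\<lambda>x. (c / x) ^ Suc m / exp (c / x) / c ^ Suc m) \<longlongrightarrow> 0 / c ^ Suc m) (at_right 0)"
    using assms by (intro tendsto_divide tendsto_const) auto
  moreover have "\<forall>\<^sub>F x in at_right 0. (c / x) ^ Suc m / exp (c / x) / c ^ Suc m = flat m c x / x"
    using assms by (auto simp: eventually_at_right_field flat_def exp_minus field_simps power_divide intro!: exI[of _ 1])
  ultimately show ?thesis
    using tendsto_cong by fastforce
qed

lemma flat_DERIV:
  assumes "c > 0"
  shows "(flat m c has_field_derivative c * flat (m + 2) c x - m * flat (m + 1) c x) (at x)"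
proof (cases x "0 :: real" rule: linorder_cases)
  case less
  have "\<forall>\<^sub>F y in nhds x. flat m c y = 0"
    using eventually_nhds_in_open[of "{..<0}" x] less by (auto elim!: eventually_mono simp: flat_def)
  then show ?thesis
    using less by (subst DERIV_cong_ev[OF refl _ refl]) (auto simp: flat_def)
next
  case greater
  have ev: "\<forall>\<^sub>F y in nhds x. flat m c y = exp (- (c / y)) / y ^ m"
    using eventually_nhds_in_open[of "{0<..}" x] greater by (auto elim!: eventually_mono simp: flat_def)
  have "((\<lambda>y. exp (- (c / y)) / y ^ m) has_field_derivative
      c * flat (m + 2) c x - m * flat (m + 1) c x) (at x)"
  proof -
    have "((\<lambda>y. exp (- (c / y))) has_field_derivative exp (- (c / x)) * (c / x\<^sup>2)) (at x)"
      using greater by (auto intro!: derivative_eq_intros simp: power2_eq_square)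
    from DERIV_quotient[OF this DERIV_pow[of m]] greater
    have "((\<lambda>y. exp (- (c / y)) / y ^ m) has_field_derivative
        (exp (- (c / x)) * (c / x\<^sup>2) * x ^ m - m * x ^ (m - 1) * exp (- (c / x))) / (x ^ m)\<^sup>2) (at x)"
      by (simp add: power2_eq_square mult.commute)
    moreover have "(exp (- (c / x)) * (c / x\<^sup>2) * x ^ m - m * x ^ (m - 1) * exp (- (c / x))) / (x ^ m)\<^sup>2
        = c * flat (m + 2) c x - m * flat (m + 1) c x"
      \<comment> \<open>The exponent \<open>m - 1\<close> is truncated at \<open>m = 0\<close>,
        where its coefficient vanishes; this case is split off.\<close>
      using greater by (cases m) (simp_all add: flat_def field_simps power2_eq_square)
    ultimately show ?thesis
      by simp
  qed
  then show ?thesis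
    by (subst DERIV_cong_ev[OF refl ev refl])
next
  case equal
  \<comment> \<open>As \<open>flat m c 0 = 0\<close>, the difference quotient at 0 is
    \<open>flat m c y / y\<close>, and the claimed derivative there is 0.\<close>
  have "((\<lambda>y. flat m c y / y) \<longlongrightarrow> 0) (at_left 0)"
    by (rule tendsto_eventually) (auto simp: eventually_at_left_field flat_def intro!: exI[of _ "-1"])
  then have "((\<lambda>y. flat m c y / y) \<longlongrightarrow> 0) (at 0)"
    using flat_quotient_tendsto_0[OF assms] by (simp add: filterlim_split_at)
  then show ?thesis
    using equal by (simp add: has_field_derivative_iff flat_def)
qed

text \<open>Each differentiation raises \<open>m\<close>, which is therefore generalized in the
  induction. The affine argument measures the distance to a lower side (\<open>s = 1\<close>) or an
  upper side (\<open>s = -1\<close>) of a box.\<close>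

lemma C_k_flat:
  assumes "c > 0"
  shows "C_k k (\<lambda>z. flat m c (s * z $ i + r))"
proof (induction k arbitrary: m)
  case 0
  have "continuous_on UNIV (flat m c)"
    using flat_DERIV[OF assms] by (meson DERIV_isCont continuous_at_imp_continuous_on)
  then show ?case
    by (auto intro!: continuous_intros continuous_on_compose2[of UNIV "flat m c"])
next
  case (Suc k)
  have "((\<lambda>z. flat m c (s * z $ i + r)) has_derivative
      (\<lambda>v. (s * v $ i) * (c * flat (m + 2) c (s * z $ i + r) + (- m) * flat (m + 1) c (s * z $ i + r)))) (at z)"
    for z :: "real^2"
  proof -
    have "((\<lambda>z::real^2. s * z $ i + r) has_derivative (\<lambda>v. s * v $ i)) (at z)"
      by (auto intro!: derivative_eq_intros bounded_linear_imp_has_derivative)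
    from has_derivative_compose[OF this flat_DERIV[OF assms, unfolded has_field_derivative_def]]
    show ?thesis
      by (simp add: algebra_simps)
  qed
  then show ?case
    by (rule C_k_SucI) (intro C_k_mult C_k_add C_k_const Suc)
qed

section \<open>Support and gradient of test functions\<close>

lemma test_functionsI:
  assumes "\<And>k. C_k k f" and "compact K" and "K \<subseteq> \<Omega>" and "\<And>x. x \<notin> K \<Longrightarrow> f x = 0"
  shows "f \<in> test_functions \<Omega>"
proof -
  have "closure {x. f x \<noteq> 0} \<subseteq> K"
    using assms(2,4) by (intro closure_minimal compact_imp_closed) auto
  moreover have "compact (closure {x. f x \<noteq> 0})"
    using calculation assms(2) by (meson bounded_subset closed_closure compact_eq_bounded_closed)
  ultimately show ?thesis
    using assms(1,3) by (auto simp: test_functions_def)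
qed

lemma test_functions_continuous: "\<psi> \<in> test_functions \<Omega> \<Longrightarrow> continuous_on UNIV \<psi>"
  by (metis (no_types, lifting) C_k_continuous mem_Collect_eq test_functions_def)

lemma test_functions_has_derivative:
  "\<psi> \<in> test_functions \<Omega> \<Longrightarrow> (\<psi> has_derivative frechet_derivative \<psi> (at x)) (at x)"
  unfolding test_functions_def using C_k_SucD(1) by blast

text \<open>Off its closed support \<open>\<psi>\<close> vanishes on an open set, so the derivative
  vanishes there too and the same compact set works.\<close>

lemma test_functions_frechet_derivative:
  assumes "\<psi> \<in> test_functions \<Omega>"
  shows "(\<lambda>x. frechet_derivative \<psi> (at x) v) \<in> test_functions \<Omega>"
proof -
  let ?K = "closure {x. \<psi> x \<noteq> 0}"
  have "frechet_derivative \<psi> (at x) v = 0" if "x \<notin> ?K" for x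
  proof -
    have "(\<psi> has_derivative (\<lambda>_. 0)) (at x)"
      by (rule has_derivative_transform_within_open[of "\<lambda>_. 0" _ _ _ "- ?K"])
        (use that closure_subset[of "{x. \<psi> x \<noteq> 0}"] in auto)
    then show ?thesis
      using frechet_derivative_at by metis
  qed
  then show ?thesis
    using assms C_k_SucD(2) unfolding test_functions_def
    by (intro test_functionsI[of _ ?K, unfolded test_functions_def]) blast+
qed

lemma grad_nth: "grad \<psi> x $ i = frechet_derivative \<psi> (at x) (axis i 1)"
  by (simp add: grad_def)

lemma test_functions_grad: "\<psi> \<in> test_functions \<Omega> \<Longrightarrow> (\<lambda>x. grad \<psi> x $ i) \<in> test_functions \<Omega>"
  by (simp add: grad_nth test_functions_frechet_derivative)

lemma frechet_derivative_eq_grad: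
  assumes "(\<psi> has_derivative D) (at x)"
  shows "D v = grad \<psi> x \<bullet> v"
proof -
  interpret bounded_linear D
    using assms has_derivative_bounded_linear by blast
  have "D v = D (\<Sum>i\<in>UNIV. v $ i *\<^sub>R axis i 1)"
    using basis_expansion[of v] by (simp add: scalar_mult_eq_scaleR)
  also have "\<dots> = (\<Sum>i\<in>UNIV. v $ i * D (axis i 1))"
    by (simp add: sum scaleR)
  finally show ?thesis
    using frechet_derivative_at[OF assms] by (simp add: inner_vec_def grad_nth mult.commute)
qed

text \<open>The chain rule pairs the outer gradient with \<open>A *v v\<close>; moving
  \<open>A\<close> to the other factor of the inner product produces the transpose.\<close>

lemma grad_compose_matrix:
  assumes "\<psi> \<in> test_functions \<Omega>"
  shows "grad (\<lambda>x. \<psi> (A *v x)) x = Finite_Cartesian_Product.transpose A *v grad \<psi> (A *v x)"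
proof -
  let ?D = "\<lambda>v. frechet_derivative \<psi> (at (A *v x)) (A *v v)"
  have "((\<lambda>x. \<psi> (A *v x)) has_derivative ?D) (at x)"
    by (rule has_derivative_compose[OF _ test_functions_has_derivative[OF assms]])
      (simp add: linear_imp_has_derivative)
  then have "grad (\<lambda>x. \<psi> (A *v x)) x \<bullet> v = ?D v" for v
    using frechet_derivative_eq_grad by metis
  also have "?D v = grad \<psi> (A *v x) \<bullet> (A *v v)" for v
    by (rule frechet_derivative_eq_grad[OF test_functions_has_derivative[OF assms]])
  finally have "grad (\<lambda>x. \<psi> (A *v x)) x \<bullet> v = (Finite_Cartesian_Product.transpose A *v grad \<psi> (A *v x)) \<bullet> v" for v
    by (simp add: dot_lmul_matrix[symmetric])
  then show ?thesis
    using vector_eq_rdot by blast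
qed

lemma matrix_inv_inverse:
  assumes "invertible A"
  shows "A ** matrix_inv A = Finite_Cartesian_Product.mat 1"
    and "matrix_inv A ** A = Finite_Cartesian_Product.mat 1"
  using someI_ex[OF assms[unfolded invertible_def]] unfolding matrix_inv_def by auto

text \<open>The composite vanishes off the image of the old support under the inverse map, which is
  compact.\<close>

lemma test_functions_compose_matrix:
  fixes A :: "real^2^2"
  assumes "\<psi> \<in> test_functions ((*v) A ` \<Omega>)" and A: "invertible A"
  shows "(\<lambda>x. \<psi> (A *v x)) \<in> test_functions \<Omega>"
proof -
  let ?K = "closure {x. \<psi> x \<noteq> 0}" and ?B = "(*v) (matrix_inv A)"
  have inv: "?B (A *v x) = x" "A *v ?B x = x" for x
    using A by (simp_all add: matrix_vector_mul_assoc matrix_inv_inverse)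
  have K: "compact ?K" "?K \<subseteq> (*v) A ` \<Omega>" and C: "\<And>k. C_k k \<psi>"
    using assms unfolding test_functions_def by blast+
  have "compact (?B ` ?K)"
    using K(1) by (intro compact_continuous_image linear_continuous_on) auto
  moreover have "?B ` ?K \<subseteq> \<Omega>"
    using K(2) inv by auto
  moreover have "\<psi> (A *v x) = 0" if "x \<notin> ?B ` ?K" for x
    using that inv(1) closure_subset by (metis (mono_tags, lifting) image_eqI mem_Collect_eq subsetD)
  ultimately show ?thesis
    using C_k_compose_linear[of "(*v) A" _ \<psi>] C by (intro test_functionsI[of _ "?B ` ?K"]) auto
qed

section \<open>The fundamental lemma of the calculus of variations\<close>

text \<open>Dynkin argument: the Borel sets over which \<open>g\<close> integrates to 0 form a
  Dynkin system containing the boxes, an intersection-stable generator. So \<open>g\<close> and 0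
  have equal integrals over all Borel sets.\<close>

lemma AE_zero_if_box_integrals_zero:
  fixes g :: "'a::euclidean_space \<Rightarrow> real"
  assumes g: "integrable lborel g" and zero: "\<And>a b. (LINT x:box a b|lborel. g x) = 0"
  shows "AE x in lborel. g x = 0"
proof (rule density_unique_real[OF g])
  have si: "set_integrable lborel A g" if "A \<in> sets borel" for A
    unfolding set_integrable_def using g that by (intro integrable_mult_indicator) auto
  \<comment> \<open>Closure under complements requires the integral over the whole space, found by
    exhausting it with growing boxes.\<close>
  have "(\<lambda>n. LINT x:box (- (real n *\<^sub>R One)) (real n *\<^sub>R One)|lborel. g x)
      \<longlonglongrightarrow> (LINT x:(\<Union>n::nat. box (- (real n *\<^sub>R One)) (real n *\<^sub>R One))|lborel. g x)"
    by (intro set_integral_cont_up si) (auto simp: incseq_def box_def inner_Basis)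
  then have total: "(LINT x:UNIV|lborel. g x) = 0"
    by (simp add: zero UN_box_eq_UNIV LIMSEQ_const_iff)
  let ?G = "range (\<lambda>(a, b). box a b :: 'a set)"
  have "Int_stable ?G"
    unfolding Int_stable_def by (auto simp: box_Int_box)
  fix A :: "'a set" assume "A \<in> sets lborel"
  then have A: "A \<in> sigma_sets UNIV ?G"
    by (subst (asm) sets_lborel, subst (asm) borel_eq_box) simp
  from \<open>Int_stable ?G\<close> subset_UNIV[of ?G, folded Pow_UNIV] A have "(LINT x:A|lborel. g x) = 0"
  proof (induction rule: sigma_sets_induct_disjoint)
    case (basic A)
    then show ?case
      using zero by auto
  next
    case empty
    show ?case
      by (simp add: set_lebesgue_integral_def)
  next
    case (compl A)
    then have [measurable]: "A \<in> sets borel"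
      by (subst borel_eq_box) simp
    have "(LINT x:A \<union> (UNIV - A)|lborel. g x) = (LINT x:A|lborel. g x) + (LINT x:UNIV - A|lborel. g x)"
      by (intro set_integral_Un si) auto
    then show ?case
      using total compl by (simp add: Un_Diff_cancel)
  next
    case (union A)
    then have "A i \<in> sets borel" for i
      by (subst borel_eq_box) auto
    then show ?case
      using union by (subst lebesgue_integral_countable_add) (auto simp: disjoint_family_on_def intro!: si)
  qed
  then show "(LINT x:A|lborel. g x) = (LINT x:A|lborel. 0)"
    by (simp add: set_lebesgue_integral_def)
qed simp

text \<open>Smooth approximations from below of the indicator of the open box. There is one factor
  per side, and in the interior each tends to 1 as the rate \<open>1 / Suc n\<close> tends to
  0.\<close>

definition bump :: "nat \<Rightarrow> real^2 \<Rightarrow> real^2 \<Rightarrow> real^2 \<Rightarrow> real" where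
  "bump n a b z = (\<Prod>i\<in>UNIV. flat 0 (1 / Suc n) (z $ i - a $ i) * flat 0 (1 / Suc n) (b $ i - z $ i))"

lemma bump_eq_0: "z \<notin> box a b \<Longrightarrow> bump n a b z = 0"
  by (auto simp: bump_def flat_def mem_box_cart not_less)

lemma bump_bounds: "0 \<le> bump n a b z" "bump n a b z \<le> 1"
proof -
  have "0 \<le> flat 0 (1 / Suc n) x \<and> flat 0 (1 / Suc n) x \<le> 1" for x
    by (simp add: flat_def)
  then show "0 \<le> bump n a b z" "bump n a b z \<le> 1"
    unfolding bump_def by (auto intro!: prod_nonneg prod_le_1 mult_le_one)
qed

lemma bump_tendsto: "(\<lambda>n. bump n a b z) \<longlonglongrightarrow> indicator (box a b) z"
proof (cases "z \<in> box a b")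
  case True
  have "(\<lambda>n. flat 0 (1 / Suc n) x) \<longlonglongrightarrow> 1" if "x > 0" for x
  proof -
    have "(\<lambda>n. 1 / x * (1 / real (Suc n))) \<longlonglongrightarrow> 1 / x * 0"
      by (intro tendsto_intros lim_1_over_n[THEN LIMSEQ_Suc])
    then have "(\<lambda>n. exp (- (1 / real (Suc n) / x))) \<longlonglongrightarrow> exp (- 0)"
      by (intro tendsto_exp tendsto_minus) (simp add: field_simps)
    then show ?thesis
      using that by (simp add: flat_def)
  qed
  then have "(\<lambda>n. bump n a b z) \<longlonglongrightarrow> (\<Prod>i\<in>(UNIV :: 2 set). 1 * 1)"
    unfolding bump_def using True by (intro tendsto_prod tendsto_mult) (auto simp: mem_box_cart)
  then show ?thesis
    using True by simp
next
  case False
  then show ?thesis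
    by (simp add: bump_eq_0)
qed

lemma bump_test_function:
  assumes "cbox a b \<subseteq> \<Omega>"
  shows "bump n a b \<in> test_functions \<Omega>"
proof (rule test_functionsI[of _ "cbox a b"])
  have "C_k k (\<lambda>z. flat 0 (1 / Suc n) (1 * z $ i + - a $ i) * flat 0 (1 / Suc n) (-1 * z $ i + b $ i))" for k i
    by (intro C_k_mult C_k_flat) auto
  then show "C_k k (bump n a b)" for k
    unfolding bump_def by (intro C_k_prod) (auto simp: algebra_simps)
  show "bump n a b z = 0" if "z \<notin> cbox a b" for z
    using that box_subset_cbox by (intro bump_eq_0) blast
qed (use assms in auto)

text \<open>Dominated convergence along the bumps; as these lie between 0 and 1, the absolute value
  of \<open>h\<close> on the closed box is a majorant.\<close>

lemma box_integral_zero_if_orthogonal: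
  fixes h :: "real^2 \<Rightarrow> real"
  assumes h: "set_integrable lebesgue (cbox a b) h"
    and orth: "\<And>n. (LINT x:cbox a b|lebesgue. bump n a b x * h x) = 0"
  shows "(LINT x:box a b|lebesgue. h x) = 0"
proof -
  have "(\<lambda>n. integral\<^sup>L lebesgue (\<lambda>x. bump n a b x * (indicator (cbox a b) x * h x)))
      \<longlonglongrightarrow> integral\<^sup>L lebesgue (\<lambda>x. indicator (box a b) x * (indicator (cbox a b) x * h x))"
  proof (rule integral_dominated_convergence)
    show "integrable lebesgue (\<lambda>x. norm (indicator (cbox a b) x * h x))"
      using h unfolding set_integrable_def by simp
    have "bump n a b \<in> borel_measurable borel" for n
      by (intro borel_measurable_continuous_onI test_functions_continuous[OF bump_test_function[of _ _ UNIV]]) simp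
    then have bump_meas: "bump n a b \<in> borel_measurable lebesgue" for n
      by (simp add: measurable_completion)
    have h_meas: "(\<lambda>x. indicator (cbox a b) x * h x) \<in> borel_measurable lebesgue"
      using h unfolding set_integrable_def by auto
    show "(\<lambda>x. bump n a b x * (indicator (cbox a b) x * h x)) \<in> borel_measurable lebesgue" for n
      by (rule borel_measurable_times[OF bump_meas h_meas])
    show "(\<lambda>x. indicator (box a b) x * (indicator (cbox a b) x * h x)) \<in> borel_measurable lebesgue"
      by (rule borel_measurable_times[OF borel_measurable_indicator h_meas]) simp
    show "AE x in lebesgue. (\<lambda>n. bump n a b x * (indicator (cbox a b) x * h x))
        \<longlonglongrightarrow> indicator (box a b) x * (indicator (cbox a b) x * h x)"
      by (intro AE_I2 tendsto_mult bump_tendsto tendsto_const)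
    show "AE x in lebesgue. norm (bump n a b x * (indicator (cbox a b) x * h x))
        \<le> norm (indicator (cbox a b) x * h x)" for n
      using bump_bounds[of n a b] by (intro AE_I2) (auto simp: abs_mult intro!: mult_left_le_one_le)
  qed
  moreover have "(\<lambda>x. indicator (box a b) x * (indicator (cbox a b) x * h x)) = (\<lambda>x. indicator (box a b) x *\<^sub>R h x)"
    using box_subset_cbox[of a b] by (auto simp: indicator_def fun_eq_iff)
  moreover have "integral\<^sup>L lebesgue (\<lambda>x. bump n a b x * (indicator (cbox a b) x * h x)) = 0" for n
    using orth[of n] by (simp add: set_lebesgue_integral_def mult.left_commute)
  ultimately show ?thesis
    unfolding set_lebesgue_integral_def by (simp only: LIMSEQ_const_iff)
qed

text \<open>On each closed box inside \<open>\<Omega>\<close>, orthogonality to the bumps makes all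
  box integrals of \<open>h\<close> vanish, hence \<open>h\<close> itself almost everywhere.
  Countably many such boxes cover \<open>\<Omega>\<close>.\<close>

lemma AE_zero_if_orthogonal_to_test_functions:
  fixes h :: "real^2 \<Rightarrow> real"
  assumes \<Omega>: "open \<Omega>" and h: "h \<in> L2 \<Omega>"
    and orth: "\<And>\<psi>. \<psi> \<in> test_functions \<Omega> \<Longrightarrow> (\<integral>x. h x * \<psi> x \<partial>lebesgue_on \<Omega>) = 0"
  shows "AE x in lebesgue_on \<Omega>. h x = 0"
proof -
  have \<Omega>_sets: "\<Omega> \<in> sets lebesgue"
    using \<Omega> by auto
  have h_meas: "(\<lambda>x. indicator \<Omega> x *\<^sub>R h x) \<in> borel_measurable lebesgue"
    using h \<Omega>_sets by (simp add: L2_def borel_measurable_restrict_space_iff)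
  have h_sq: "integrable lebesgue (\<lambda>x. indicator \<Omega> x *\<^sub>R (h x)\<^sup>2)"
    using h \<Omega>_sets by (simp add: L2_def integrable_restrict_space)
  have si: "set_integrable lebesgue (cbox a b) h" if "cbox a b \<subseteq> \<Omega>" for a b
    unfolding set_integrable_def
  proof (rule Bochner_Integration.integrable_bound)
    show "integrable lebesgue (\<lambda>x. indicator (cbox a b) x + indicator \<Omega> x *\<^sub>R (h x)\<^sup>2)"
      using h_sq emeasure_lborel_cbox_finite[of a b]
      by (intro Bochner_Integration.integrable_add integrable_real_indicator) auto
    have "(\<lambda>x. indicator (cbox a b) x *\<^sub>R h x) = (\<lambda>x. indicator (cbox a b) x *\<^sub>R (indicator \<Omega> x *\<^sub>R h x))"
      using that by (auto simp: indicator_def fun_eq_iff)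
    then show "(\<lambda>x. indicator (cbox a b) x *\<^sub>R h x) \<in> borel_measurable lebesgue"
      using borel_measurable_scaleR[OF borel_measurable_indicator h_meas, of "cbox a b"] by simp
    \<comment> \<open>From \<open>(|y| - 1/2)^2 \<ge> 0\<close>. It makes a square-integrable
      function integrable over a set of finite measure.\<close>
    have "\<bar>y\<bar> \<le> 1 + y\<^sup>2" for y :: real
      using sum_squares_ge_zero[of "\<bar>y\<bar> - 1/2" 0] by (simp add: power2_eq_square algebra_simps)
    then show "AE x in lebesgue. norm (indicator (cbox a b) x *\<^sub>R h x)
        \<le> norm (indicator (cbox a b) x + indicator \<Omega> x *\<^sub>R (h x)\<^sup>2)"
      using that by (intro AE_I2) (auto simp: indicator_def)
  qed
  have box0: "(LINT x:box a b|lebesgue. h x) = 0" if "cbox a b \<subseteq> \<Omega>" for a b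
  proof (rule box_integral_zero_if_orthogonal[OF si[OF that]])
    fix n
    have "(\<lambda>x. indicator \<Omega> x *\<^sub>R (h x * bump n a b x)) = (\<lambda>x. indicator (cbox a b) x *\<^sub>R (bump n a b x * h x))"
    proof
      fix x
      show "indicator \<Omega> x *\<^sub>R (h x * bump n a b x) = indicator (cbox a b) x *\<^sub>R (bump n a b x * h x)"
      proof (cases "x \<in> cbox a b")
        case True
        then show ?thesis
          using that by (auto simp: indicator_def)
      next
        case False
        then have "bump n a b x = 0"
          using box_subset_cbox[of a b] by (intro bump_eq_0) auto
        then show ?thesis
          by simp
      qed
    qed
    then show "(LINT x:cbox a b|lebesgue. bump n a b x * h x) = 0"
      using orth[OF bump_test_function[OF that, of n]] \<Omega>_sets
      unfolding set_lebesgue_integral_def by (subst (asm) integral_restrict_space) simp_all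
  qed
  have box_AE: "AE x in lebesgue. x \<in> cbox a b \<longrightarrow> h x = 0" if ab: "cbox a b \<subseteq> \<Omega>" for a b
  proof -
    \<comment> \<open>Truncation gives a function integrable on the whole plane. The Dynkin argument
      concerns \<open>lborel\<close>, so \<open>g\<close> is then replaced by a Borel representative
      \<open>g'\<close>.\<close>
    define g where "g x = indicator (cbox a b) x *\<^sub>R h x" for x
    have g: "integrable lebesgue g"
      using si[OF ab] unfolding g_def set_integrable_def .
    obtain g' where g': "g' \<in> borel_measurable lborel" "AE x in lborel. g x = g' x"
      using completion_ex_borel_measurable_real[OF borel_measurable_integrable[OF g]] by auto
    have ae: "AE x in lebesgue. g x = g' x"
      using g'(2) by (rule AE_completion)
    have "integrable lebesgue g'"
      using g ae g'(1) by (subst integrable_cong_AE[of _ _ g]) (auto intro: measurable_completion)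
    then have "integrable lborel g'"
      using g'(1) by (simp add: integrable_completion)
    moreover have "(LINT x:box c d|lborel. g' x) = 0" for c d
    proof -
      obtain e f where ef: "box a b \<inter> box c d = box e f"
        using box_Int_box[of a b c d] by blast
      have "(LINT x:box c d|lborel. g' x) = (LINT x:box c d|lebesgue. g' x)"
        using g'(1) unfolding set_lebesgue_integral_def by (subst integral_completion) auto
      also have "\<dots> = (LINT x:box c d|lebesgue. g x)"
        using g'(1) g ae unfolding set_lebesgue_integral_def
        by (intro integral_cong_AE borel_measurable_scaleR borel_measurable_indicator)
          (auto intro: measurable_completion)
      also have "\<dots> = (LINT x:box e f|lebesgue. h x)"
      proof -
        \<comment> \<open>\<open>g\<close> is cut off at the closed box, whereas
          \<open>box e f\<close> is the intersection with the open one; the boundary between them is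
          null.\<close>
        have "AE x in lebesgue. x \<notin> cbox a b - box a b"
          using negligible_frontier_interval[of a b] unfolding negligible_iff_null_sets by (rule AE_not_in)
        then have "AE x in lebesgue. indicator (box c d) x *\<^sub>R g x = indicator (box e f) x *\<^sub>R g x"
          unfolding ef[symmetric] by eventually_elim (auto simp: g_def indicator_def)
        then have "(LINT x:box c d|lebesgue. g x) = (LINT x:box e f|lebesgue. g x)"
          using g unfolding set_lebesgue_integral_def
          by (intro integral_cong_AE borel_measurable_scaleR borel_measurable_indicator) auto
        moreover have "(\<lambda>x. indicator (box e f) x *\<^sub>R g x) = (\<lambda>x. indicator (box e f) x *\<^sub>R h x)"
          using box_subset_cbox[of a b] unfolding ef[symmetric] g_def by (auto simp: indicator_def fun_eq_iff)
        ultimately show ?thesis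
          unfolding set_lebesgue_integral_def by simp
      qed
      also have "\<dots> = 0"
      \<comment> \<open>If \<open>box e f\<close> is empty, \<open>cbox e f\<close> may be a
        degenerate box outside \<open>cbox a b\<close>; otherwise it is the closure of
        \<open>box e f\<close> and stays inside.\<close>
      proof (cases "box e f = {}")
        case False
        then have "cbox e f \<subseteq> cbox a b"
          by (metis Int_lower1 closure_box closure_mono ef inf_bot_left)
        then show ?thesis
          using ab by (intro box0) auto
      qed (simp add: set_lebesgue_integral_def)
      finally show ?thesis .
    qed
    ultimately have "AE x in lborel. g' x = 0"
      by (rule AE_zero_if_box_integrals_zero)
    then have "AE x in lebesgue. g x = 0"
      using ae by (auto dest: AE_completion)
    then show ?thesis
      by eventually_elim (auto simp: g_def)
  qed
  obtain \<D> where \<D>: "countable \<D>" "\<D> \<subseteq> Pow \<Omega>" "\<And>X. X \<in> \<D> \<Longrightarrow> \<exists>a b. X = cbox a b" "\<Union>\<D> = \<Omega>"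
    using open_countable_Union_open_cbox[OF \<Omega>] by blast
  have "AE x in lebesgue. x \<in> X \<longrightarrow> h x = 0" if "X \<in> \<D>" for X
  proof -
    obtain a b where "X = cbox a b"
      using \<D>(3) \<open>X \<in> \<D>\<close> by blast
    then show ?thesis
      using box_AE[of a b] \<D>(2) that by auto
  qed
  then have "AE x in lebesgue. \<forall>X\<in>\<D>. x \<in> X \<longrightarrow> h x = 0"
    unfolding AE_ball_countable[OF \<D>(1)] by blast
  then have "AE x in lebesgue. x \<in> \<Omega> \<longrightarrow> h x = 0"
    by eventually_elim (use \<D>(4) in auto)
  then show ?thesis
    using \<Omega>_sets by (simp add: AE_restrict_space_iff)
qed

section \<open>Square-integrable functions and weak gradients\<close>

text \<open>Completeness of Lebesgue measure: the set of disagreement is null, so the values of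
  \<open>g\<close> on it cannot destroy measurability.\<close>

lemma borel_measurable_lebesgue_on_cong_AE:
  fixes f g :: "'a::euclidean_space \<Rightarrow> 'b::euclidean_space"
  assumes "f \<in> borel_measurable (lebesgue_on S)" "AE x in lebesgue_on S. g x = f x" "S \<in> sets lebesgue"
  shows "g \<in> borel_measurable (lebesgue_on S)"
proof -
  let ?N = "{x \<in> S. g x \<noteq> f x}"
  have "AE x in lebesgue. x \<in> S \<longrightarrow> g x = f x"
    using assms(2,3) by (simp add: AE_restrict_space_iff)
  then have "?N \<in> null_sets lebesgue"
    by (simp add: completion.AE_iff_null_sets)
  then have "?N \<in> null_sets (lebesgue_on S)"
    using assms(3) by (auto simp: null_sets_restrict_space)
  moreover have "g \<in> borel_measurable (lebesgue_on (S - ?N))"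
  proof -
    have "f \<in> borel_measurable (lebesgue_on (S - ?N))"
      using assms(1) by (rule measurable_restrict_mono) auto
    then show ?thesis
      by (subst measurable_lebesgue_cong[where g = f]) auto
  qed
  ultimately show ?thesis
    using borel_measurable_diff_null assms(3) by blast
qed

lemma L2_measurable: "f \<in> L2 \<Omega> \<Longrightarrow> f \<in> borel_measurable (lebesgue_on \<Omega>)"
  by (simp add: L2_def)

lemma L2_dominated:
  assumes "f \<in> L2 \<Omega>" and "g \<in> borel_measurable (lebesgue_on \<Omega>)"
    and "\<And>x. x \<in> \<Omega> \<Longrightarrow> norm (g x) \<le> K * norm (f x)"
  shows "g \<in> L2 \<Omega>"
proof -
  have "integrable (lebesgue_on \<Omega>) (\<lambda>x. (norm (g x))\<^sup>2)"
  proof (rule Bochner_Integration.integrable_bound)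
    show "integrable (lebesgue_on \<Omega>) (\<lambda>x. K\<^sup>2 * (norm (f x))\<^sup>2)"
      using assms(1) by (simp add: L2_def)
    show "AE x in lebesgue_on \<Omega>. norm ((norm (g x))\<^sup>2) \<le> norm (K\<^sup>2 * (norm (f x))\<^sup>2)"
      using assms(3) by (intro AE_I2) (auto simp: power_mult_distrib[symmetric] intro!: power_mono)
    show "(\<lambda>x. (norm (g x))\<^sup>2) \<in> borel_measurable (lebesgue_on \<Omega>)"
      by (intro borel_measurable_power measurable_compose[OF assms(2) borel_measurable_norm])
  qed
  then show ?thesis
    using assms(2) by (simp add: L2_def)
qed

lemma L2_add:
  assumes "f \<in> L2 \<Omega>" "g \<in> L2 \<Omega>"
  shows "(\<lambda>x. f x + g x) \<in> L2 \<Omega>"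
proof -
  note [measurable] = L2_measurable[OF assms(1)] L2_measurable[OF assms(2)]
  have "integrable (lebesgue_on \<Omega>) (\<lambda>x. (norm (f x + g x))\<^sup>2)"
  proof (rule Bochner_Integration.integrable_bound)
    show "integrable (lebesgue_on \<Omega>) (\<lambda>x. 2 * (norm (f x))\<^sup>2 + 2 * (norm (g x))\<^sup>2)"
      using assms by (simp add: L2_def)
    \<comment> \<open>Parallelogram law: the two sides differ by
      \<open>(norm (f x - g x))\<^sup>2\<close>.\<close>
    have "(norm (f x + g x))\<^sup>2 \<le> 2 * (norm (f x))\<^sup>2 + 2 * (norm (g x))\<^sup>2" for x
      using zero_le_power2[of "norm (f x - g x)"]
      by (simp add: power2_norm_eq_inner inner_diff inner_add inner_commute)
    then show "AE x in lebesgue_on \<Omega>. norm ((norm (f x + g x))\<^sup>2) \<le> norm (2 * (norm (f x))\<^sup>2 + 2 * (norm (g x))\<^sup>2)"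
      by (intro AE_I2) auto
  qed measurable
  then show ?thesis
    by (simp add: L2_def)
qed

lemma L2_scaleR: "f \<in> L2 \<Omega> \<Longrightarrow> (\<lambda>x. c *\<^sub>R f x) \<in> L2 \<Omega>"
  by (rule L2_dominated[where K = "\<bar>c\<bar>"]) (auto simp: L2_def)

lemma L2_diff: "f \<in> L2 \<Omega> \<Longrightarrow> g \<in> L2 \<Omega> \<Longrightarrow> (\<lambda>x. f x - g x) \<in> L2 \<Omega>"
  using L2_add[of f \<Omega> "\<lambda>x. (-1) *\<^sub>R g x"] L2_scaleR[of g \<Omega> "-1"] by simp

lemma L2_sum: "finite I \<Longrightarrow> (\<And>i. i \<in> I \<Longrightarrow> f i \<in> L2 \<Omega>) \<Longrightarrow> (\<lambda>x. \<Sum>i\<in>I. f i x) \<in> L2 \<Omega>"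
proof (induction I rule: finite_induct)
  case empty
  then show ?case by (simp add: L2_def)
next
  case (insert i I)
  then show ?case by (simp add: L2_add)
qed

lemma L2_linear_comb:
  "finite I \<Longrightarrow> (\<And>i. i \<in> I \<Longrightarrow> f i \<in> L2 \<Omega>) \<Longrightarrow> (\<lambda>x. \<Sum>i\<in>I. c i *\<^sub>R f i x) \<in> L2 \<Omega>"
  by (intro L2_sum L2_scaleR)

lemma L2_bounded_linear:
  assumes "bounded_linear B" "f \<in> L2 \<Omega>"
  shows "(\<lambda>x. B (f x)) \<in> L2 \<Omega>"
proof -
  obtain K where "\<And>x. norm (B x) \<le> norm x * K"
    using bounded_linear.bounded[OF assms(1)] by blast
  moreover have "B \<in> borel_measurable borel"
    using assms(1) by (intro borel_measurable_continuous_onI linear_continuous_on)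
  ultimately show ?thesis
    using measurable_compose[OF L2_measurable[OF assms(2)], of B]
    by (intro L2_dominated[OF assms(2), where K = K]) (auto simp: mult.commute)
qed

lemma L2_nth: "f \<in> L2 \<Omega> \<Longrightarrow> (\<lambda>x. f x $ i) \<in> L2 \<Omega>"
  by (rule L2_bounded_linear) (rule bounded_linear_vec_nth)

lemma L2_vec:
  fixes f :: "real^2 \<Rightarrow> real^'n"
  assumes "\<And>i. (\<lambda>x. f x $ i) \<in> L2 \<Omega>"
  shows "f \<in> L2 \<Omega>"
proof -
  have "(\<lambda>x. axis i (f x $ i)) \<in> L2 \<Omega>" for i
    by (rule L2_bounded_linear[OF _ assms]) (intro linear_conv_bounded_linear[THEN iffD1], simp add: linear_iff axis_def Finite_Cartesian_Product.vec_eq_iff)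
  then have "(\<lambda>x. \<Sum>i\<in>UNIV. axis i (f x $ i)) \<in> L2 \<Omega>"
    by (intro L2_sum) auto
  moreover have "(\<Sum>i\<in>UNIV. axis i (v $ i)) = v" for v :: "real^'n"
    by (auto simp: Finite_Cartesian_Product.vec_eq_iff axis_def)
  ultimately show ?thesis
    by simp
qed

lemma L2_cong_AE:
  assumes "f \<in> L2 \<Omega>" "AE x in lebesgue_on \<Omega>. g x = f x" "\<Omega> \<in> sets lebesgue"
  shows "g \<in> L2 \<Omega>"
proof -
  have g: "g \<in> borel_measurable (lebesgue_on \<Omega>)"
    by (rule borel_measurable_lebesgue_on_cong_AE[OF L2_measurable[OF assms(1)] assms(2,3)])
  have ae: "AE x in lebesgue_on \<Omega>. (norm (f x))\<^sup>2 = (norm (g x))\<^sup>2"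
    using assms(2) by eventually_elim simp
  have "integrable (lebesgue_on \<Omega>) (\<lambda>x. (norm (f x))\<^sup>2)"
    using assms(1) by (simp add: L2_def)
  then have "integrable (lebesgue_on \<Omega>) (\<lambda>x. (norm (g x))\<^sup>2)"
    by (rule integrable_cong_AE_imp[OF _ borel_measurable_power[OF measurable_compose[OF g borel_measurable_norm]] ae])
  with g show ?thesis
    by (simp add: L2_def)
qed

lemma L2_inner_integrable:
  assumes "f \<in> L2 \<Omega>" "g \<in> L2 \<Omega>"
  shows "integrable (lebesgue_on \<Omega>) (\<lambda>x. f x \<bullet> g x)"
proof (rule Bochner_Integration.integrable_bound)
  show "integrable (lebesgue_on \<Omega>) (\<lambda>x. (norm (f x))\<^sup>2 + (norm (g x))\<^sup>2)"
    using assms by (simp add: L2_def)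
  show "(\<lambda>x. f x \<bullet> g x) \<in> borel_measurable (lebesgue_on \<Omega>)"
    using assms by (auto simp: L2_def)
  have "\<bar>f x \<bullet> g x\<bar> \<le> (norm (f x))\<^sup>2 + (norm (g x))\<^sup>2" for x
  proof -
    have "\<bar>f x \<bullet> g x\<bar> \<le> norm (f x) * norm (g x)"
      by (rule Cauchy_Schwarz_ineq2)
    also have "\<dots> \<le> 2 * norm (f x) * norm (g x)"
      by simp
    also have "\<dots> \<le> (norm (f x))\<^sup>2 + (norm (g x))\<^sup>2"
      by (rule sum_squares_bound)
    finally show ?thesis .
  qed
  then show "AE x in lebesgue_on \<Omega>. norm (f x \<bullet> g x) \<le> norm ((norm (f x))\<^sup>2 + (norm (g x))\<^sup>2)"
    by (intro AE_I2) auto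
qed

lemma L2_mult_integrable:
  fixes f g :: "real^2 \<Rightarrow> real"
  shows "f \<in> L2 \<Omega> \<Longrightarrow> g \<in> L2 \<Omega> \<Longrightarrow> integrable (lebesgue_on \<Omega>) (\<lambda>x. f x * g x)"
  using L2_inner_integrable[of f \<Omega> g] by simp

lemma l2_inner_cong_AE:
  assumes "f \<in> L2 \<Omega>" "g \<in> L2 \<Omega>" "\<Omega> \<in> sets lebesgue"
    and "AE x in lebesgue_on \<Omega>. f' x = f x" "AE x in lebesgue_on \<Omega>. g' x = g x"
  shows "l2_inner \<Omega> f' g' = l2_inner \<Omega> f g"
  unfolding l2_inner_def
proof (rule integral_cong_AE)
  have "f' \<in> L2 \<Omega>" "g' \<in> L2 \<Omega>"
    using assms by (auto intro: L2_cong_AE)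
  then show "(\<lambda>x. f' x \<bullet> g' x) \<in> borel_measurable (lebesgue_on \<Omega>)"
    using L2_inner_integrable by blast
  show "(\<lambda>x. f x \<bullet> g x) \<in> borel_measurable (lebesgue_on \<Omega>)"
    using L2_inner_integrable assms by blast
  show "AE x in lebesgue_on \<Omega>. f' x \<bullet> g' x = f x \<bullet> g x"
    using assms(4,5) by eventually_elim simp
qed

lemma l2_inner_sum_left:
  assumes "finite I" "\<And>i. i \<in> I \<Longrightarrow> f i \<in> L2 \<Omega>" "g \<in> L2 \<Omega>"
  shows "l2_inner \<Omega> (\<lambda>x. \<Sum>i\<in>I. c i *\<^sub>R f i x) g = (\<Sum>i\<in>I. c i * l2_inner \<Omega> (f i) g)"
proof -
  have "integrable (lebesgue_on \<Omega>) (\<lambda>x. c i * (f i x \<bullet> g x))" if "i \<in> I" for i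
    using L2_inner_integrable[OF assms(2,3)] that by simp
  then show ?thesis
    by (simp add: l2_inner_def inner_sum_left)
qed

lemma l2_inner_diff_left:
  "f \<in> L2 \<Omega> \<Longrightarrow> f' \<in> L2 \<Omega> \<Longrightarrow> g \<in> L2 \<Omega> \<Longrightarrow>
    l2_inner \<Omega> (\<lambda>x. f x - f' x) g = l2_inner \<Omega> f g - l2_inner \<Omega> f' g"
  by (simp add: l2_inner_def inner_diff_left L2_inner_integrable)

lemma l2_inner_scaleR_left: "l2_inner \<Omega> (\<lambda>x. c *\<^sub>R f x) g = c * l2_inner \<Omega> f g"
  by (simp add: l2_inner_def)

lemma l2_inner_commute: "l2_inner \<Omega> f g = l2_inner \<Omega> g f"
  by (simp add: l2_inner_def inner_commute)

lemma test_functions_L2: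
  assumes "\<psi> \<in> test_functions \<Omega>" and \<Omega>: "\<Omega> \<in> sets lebesgue"
  shows "\<psi> \<in> L2 \<Omega>"
proof -
  let ?K = "closure {x. \<psi> x \<noteq> 0}"
  have cont: "continuous_on UNIV \<psi>"
    using assms(1) by (rule test_functions_continuous)
  have "integrable lborel (\<lambda>x. indicator ?K x *\<^sub>R (\<psi> x)\<^sup>2)"
    using assms(1) continuous_on_subset[OF cont]
    by (intro borel_integrable_compact) (auto simp: test_functions_def intro!: continuous_intros)
  moreover have "(\<lambda>x. indicator ?K x *\<^sub>R (\<psi> x)\<^sup>2) = (\<lambda>x. (\<psi> x)\<^sup>2)"
    using closure_subset[of "{x. \<psi> x \<noteq> 0}"] by (auto simp: fun_eq_iff indicator_def)
  ultimately have "integrable lborel (\<lambda>x. (\<psi> x)\<^sup>2)"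
    by simp
  then have "integrable lebesgue (\<lambda>x. (\<psi> x)\<^sup>2)"
    by (simp add: integrable_completion)
  then have "integrable (lebesgue_on \<Omega>) (\<lambda>x. (\<psi> x)\<^sup>2)"
    using \<Omega> integrable_mult_indicator[of \<Omega> lebesgue "\<lambda>x. (\<psi> x)\<^sup>2"] by (simp add: integrable_restrict_space)
  moreover have "\<psi> \<in> borel_measurable (lebesgue_on \<Omega>)"
    using borel_measurable_continuous_onI[OF cont]
    by (intro measurable_restrict_space1 measurable_completion) simp
  ultimately show ?thesis
    by (simp add: L2_def)
qed

lemma test_functions_grad_L2: "\<psi> \<in> test_functions \<Omega> \<Longrightarrow> \<Omega> \<in> sets lebesgue \<Longrightarrow> grad \<psi> \<in> L2 \<Omega>"
  by (intro L2_vec test_functions_L2 test_functions_grad)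

section \<open>Weak gradients: uniqueness and linear combinations\<close>

lemma H1_weak_grad: "u \<in> H1 \<Omega> \<Longrightarrow> is_weak_grad \<Omega> u (weak_grad \<Omega> u)"
  unfolding weak_grad_def using someI_ex[of "is_weak_grad \<Omega> u"] by (simp add: H1_def)

lemma H1_L2: "u \<in> H1 \<Omega> \<Longrightarrow> u \<in> L2 \<Omega>"
  by (simp add: H1_def)

lemma is_weak_grad_L2: "is_weak_grad \<Omega> u g \<Longrightarrow> g \<in> L2 \<Omega>"
  by (simp add: is_weak_grad_def)

lemma weak_grad_L2: "u \<in> H1 \<Omega> \<Longrightarrow> weak_grad \<Omega> u \<in> L2 \<Omega>"
  using H1_weak_grad is_weak_grad_L2 by blast

lemma H10_H1: "u \<in> H10 \<Omega> \<Longrightarrow> u \<in> H1 \<Omega>"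
  by (simp add: H10_def)

text \<open>Both candidates have the same integrals against every test function, so each component
  of their difference falls under the fundamental lemma.\<close>

lemma is_weak_grad_unique:
  assumes \<Omega>: "open \<Omega>" and g: "is_weak_grad \<Omega> u g" "is_weak_grad \<Omega> u g'"
  shows "AE x in lebesgue_on \<Omega>. g x = g' x"
proof -
  have \<Omega>_sets: "\<Omega> \<in> sets lebesgue"
    using \<Omega> by auto
  have "AE x in lebesgue_on \<Omega>. g x $ i - g' x $ i = 0" for i
  proof (rule AE_zero_if_orthogonal_to_test_functions[OF \<Omega>])
    show L2: "(\<lambda>x. g x $ i - g' x $ i) \<in> L2 \<Omega>"
      using g by (intro L2_diff L2_nth) (auto intro: is_weak_grad_L2)
    fix \<psi> assume \<psi>: "\<psi> \<in> test_functions \<Omega>"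
    then have "integrable (lebesgue_on \<Omega>) (\<lambda>x. g x $ i * \<psi> x)" "integrable (lebesgue_on \<Omega>) (\<lambda>x. g' x $ i * \<psi> x)"
      using g by (auto intro!: L2_mult_integrable L2_nth test_functions_L2 \<Omega>_sets intro: is_weak_grad_L2)
    moreover have "(\<integral>x. g x $ i * \<psi> x \<partial>lebesgue_on \<Omega>) = (\<integral>x. g' x $ i * \<psi> x \<partial>lebesgue_on \<Omega>)"
    proof -
      have "(\<integral>x. u x * grad \<psi> x $ i \<partial>lebesgue_on \<Omega>) = - (\<integral>x. g x $ i * \<psi> x \<partial>lebesgue_on \<Omega>)"
        "(\<integral>x. u x * grad \<psi> x $ i \<partial>lebesgue_on \<Omega>) = - (\<integral>x. g' x $ i * \<psi> x \<partial>lebesgue_on \<Omega>)"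
        using g \<psi> unfolding is_weak_grad_def by blast+
      then show ?thesis
        by simp
    qed
    ultimately show "(\<integral>x. (g x $ i - g' x $ i) * \<psi> x \<partial>lebesgue_on \<Omega>) = 0"
      by (simp add: left_diff_distrib)
  qed
  then have "AE x in lebesgue_on \<Omega>. \<forall>i. g x $ i - g' x $ i = 0"
    by (simp add: AE_all_countable)
  then show ?thesis
    by eventually_elim (simp add: Finite_Cartesian_Product.vec_eq_iff)
qed

text \<open>The bridge from an explicitly computed weak gradient to the chosen
  representative.\<close>

lemma weak_grad_AE:
  assumes "open \<Omega>" "is_weak_grad \<Omega> u g"
  shows "AE x in lebesgue_on \<Omega>. weak_grad \<Omega> u x = g x"
  unfolding weak_grad_def by (rule is_weak_grad_unique[OF assms(1) someI[of "is_weak_grad \<Omega> u", OF assms(2)] assms(2)])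

text \<open>The identity for \<open>v\<close> is assumed only almost everywhere, because that is
  what membership in \<open>span_ae\<close> provides.\<close>

lemma is_weak_grad_linear_comb:
  assumes \<Omega>: "\<Omega> \<in> sets lebesgue" and "finite I" and u: "\<And>i. i \<in> I \<Longrightarrow> u i \<in> L2 \<Omega>"
    and g: "\<And>i. i \<in> I \<Longrightarrow> is_weak_grad \<Omega> (u i) (g i)"
    and v: "AE x in lebesgue_on \<Omega>. v x = (\<Sum>i\<in>I. c i * u i x)"
  shows "is_weak_grad \<Omega> v (\<lambda>x. \<Sum>i\<in>I. c i *\<^sub>R g i x)"
  unfolding is_weak_grad_def
proof (intro conjI ballI allI)
  show "(\<lambda>x. \<Sum>i\<in>I. c i *\<^sub>R g i x) \<in> L2 \<Omega>"
    using \<open>finite I\<close> is_weak_grad_L2[OF g] by (rule L2_linear_comb)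
  fix \<psi> k assume \<psi>: "\<psi> \<in> test_functions \<Omega>"
  let ?d = "\<lambda>x. grad \<psi> x $ k"
  have comb: "(\<lambda>x. \<Sum>i\<in>I. c i *\<^sub>R u i x) \<in> L2 \<Omega>"
    using \<open>finite I\<close> u by (rule L2_linear_comb)
  have d: "?d \<in> L2 \<Omega>"
    using \<psi> \<Omega> by (intro test_functions_L2 test_functions_grad)
  have "(\<integral>x. v x * ?d x \<partial>lebesgue_on \<Omega>) = l2_inner \<Omega> (\<lambda>x. \<Sum>i\<in>I. c i *\<^sub>R u i x) ?d"
    using l2_inner_cong_AE[OF comb d \<Omega>, of v ?d] v by (simp add: l2_inner_def)
  also have "\<dots> = (\<Sum>i\<in>I. c i * (\<integral>x. u i x * ?d x \<partial>lebesgue_on \<Omega>))"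
    using l2_inner_sum_left[OF \<open>finite I\<close> u d] by (simp add: l2_inner_def)
  also have "\<dots> = - (\<Sum>i\<in>I. c i * (\<integral>x. g i x $ k * \<psi> x \<partial>lebesgue_on \<Omega>))"
    using g \<psi> by (simp add: is_weak_grad_def sum_negf)
  also have "(\<Sum>i\<in>I. c i * (\<integral>x. g i x $ k * \<psi> x \<partial>lebesgue_on \<Omega>))
      = l2_inner \<Omega> (\<lambda>x. \<Sum>i\<in>I. c i *\<^sub>R g i x $ k) \<psi>"
    using l2_inner_sum_left[OF \<open>finite I\<close> L2_nth[OF is_weak_grad_L2[OF g]] test_functions_L2[OF \<psi> \<Omega>]]
    by (simp add: l2_inner_def)
  finally show "(\<integral>x. v x * ?d x \<partial>lebesgue_on \<Omega>)
      = - (\<integral>x. (\<Sum>i\<in>I. c i *\<^sub>R g i x) $ k * \<psi> x \<partial>lebesgue_on \<Omega>)"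
    by (simp add: l2_inner_def)
qed

lemma H1_linear_comb:
  assumes \<Omega>: "open \<Omega>" and "finite I" and u: "\<And>i. i \<in> I \<Longrightarrow> u i \<in> H1 \<Omega>"
    and v: "AE x in lebesgue_on \<Omega>. v x = (\<Sum>i\<in>I. c i * u i x)"
  shows "v \<in> H1 \<Omega>"
    and "AE x in lebesgue_on \<Omega>. weak_grad \<Omega> v x = (\<Sum>i\<in>I. c i *\<^sub>R weak_grad \<Omega> (u i) x)"
proof -
  have \<Omega>_sets: "\<Omega> \<in> sets lebesgue"
    using \<Omega> by auto
  have wg: "is_weak_grad \<Omega> v (\<lambda>x. \<Sum>i\<in>I. c i *\<^sub>R weak_grad \<Omega> (u i) x)"
    using H1_L2[OF u] H1_weak_grad[OF u] by (rule is_weak_grad_linear_comb[OF \<Omega>_sets \<open>finite I\<close> _ _ v])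
  moreover have "v \<in> L2 \<Omega>"
    using L2_cong_AE[OF L2_linear_comb[OF \<open>finite I\<close> H1_L2[OF u]]] v \<Omega>_sets by simp
  ultimately show "v \<in> H1 \<Omega>"
    by (auto simp: H1_def)
  show "AE x in lebesgue_on \<Omega>. weak_grad \<Omega> v x = (\<Sum>i\<in>I. c i *\<^sub>R weak_grad \<Omega> (u i) x)"
    using \<Omega> wg by (rule weak_grad_AE)
qed

section \<open>Linear changes of variables\<close>

lemma matrix_inv_vector_mul:
  fixes A :: "real^'n^'n"
  assumes "invertible A"
  shows "matrix_inv A *v (A *v x) = x" "A *v (matrix_inv A *v x) = x"
  using assms by (simp_all add: matrix_vector_mul_assoc matrix_inv_inverse)

lemma linear_image_lmeasurable:
  fixes A :: "real^2^2"
  shows "X \<in> lmeasurable \<Longrightarrow> (*v) A ` X \<in> lmeasurable"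
  by (rule measurable_linear_image) auto

lemma sets_lebesgue_on_lmeasurable:
  assumes "X \<in> sets (lebesgue_on \<Omega>)" "\<Omega> \<in> lmeasurable"
  shows "X \<subseteq> \<Omega>" "X \<in> lmeasurable"
  using assms fmeasurableI2[OF assms(2), of X] fmeasurableD[OF assms(2)]
  by (simp_all add: sets_restrict_space_iff)

lemma matrix_vimage_eq_image:
  fixes A :: "real^2^2"
  assumes "invertible A" "X \<subseteq> (*v) A ` \<Omega>"
  shows "(*v) A -` X \<inter> \<Omega> = (*v) (matrix_inv A) ` X"
proof (rule Set.set_eqI, rule iffI)
  fix x assume "x \<in> (*v) A -` X \<inter> \<Omega>"
  then show "x \<in> (*v) (matrix_inv A) ` X"
    using matrix_inv_vector_mul(1)[OF assms(1), of x] by (metis Int_iff image_eqI vimage_eq)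
next
  fix x assume "x \<in> (*v) (matrix_inv A) ` X"
  then obtain y where y: "y \<in> X" "x = matrix_inv A *v y"
    by blast
  then obtain z where "z \<in> \<Omega>" "y = A *v z"
    using assms(2) by blast
  then show "x \<in> (*v) A -` X \<inter> \<Omega>"
    using y matrix_inv_vector_mul(1)[OF assms(1), of z] by simp
qed

text \<open>Continuity only handles preimages of Borel sets. For Lebesgue sets the preimage is
  written as an image under the inverse linear map, and linear images of \<open>lmeasurable\<close>
  sets are \<open>lmeasurable\<close>.\<close>

lemma matrix_measurable_lebesgue_on:
  fixes A :: "real^2^2"
  assumes A: "invertible A" and \<Omega>: "\<Omega> \<in> lmeasurable"
  shows "(*v) A \<in> lebesgue_on \<Omega> \<rightarrow>\<^sub>M lebesgue_on ((*v) A ` \<Omega>)"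
proof (rule measurableI)
  fix X assume "X \<in> sets (lebesgue_on ((*v) A ` \<Omega>))"
  note X = sets_lebesgue_on_lmeasurable[OF this linear_image_lmeasurable[OF \<Omega>]]
  have "(*v) (matrix_inv A) ` X \<in> sets lebesgue"
    using linear_image_lmeasurable[OF X(2)] by (rule fmeasurableD)
  then have "(*v) A -` X \<inter> \<Omega> \<in> sets lebesgue"
    using matrix_vimage_eq_image[OF A X(1)] by simp
  then show "(*v) A -` X \<inter> space (lebesgue_on \<Omega>) \<in> sets (lebesgue_on \<Omega>)"
    using fmeasurableD[OF \<Omega>] by (simp add: sets_restrict_space_iff)
qed simp

text \<open>The change of variables as an identity of measures, from which the transfer of null
  sets, integrability and integrals all follow. The constant is the factor by which the inverse map
  scales area.\<close>

lemma distr_lebesgue_on_matrix: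
  fixes A :: "real^2^2"
  assumes A: "invertible A" and \<Omega>: "\<Omega> \<in> lmeasurable"
  shows "distr (lebesgue_on \<Omega>) (lebesgue_on ((*v) A ` \<Omega>)) ((*v) A)
      = density (lebesgue_on ((*v) A ` \<Omega>)) (\<lambda>_. ennreal (1 / \<bar>Determinants.det A\<bar>))"
proof (rule measure_eqI)
  fix X assume "X \<in> sets (distr (lebesgue_on \<Omega>) (lebesgue_on ((*v) A ` \<Omega>)) ((*v) A))"
  then have X_sets: "X \<in> sets (lebesgue_on ((*v) A ` \<Omega>))"
    by simp
  have A\<Omega>: "(*v) A ` \<Omega> \<in> lmeasurable"
    by (rule linear_image_lmeasurable[OF \<Omega>])
  note X = sets_lebesgue_on_lmeasurable[OF X_sets A\<Omega>]
  have "Determinants.det (A ** matrix_inv A) = 1"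
    using matrix_inv_inverse[OF A] by simp
  then have "Determinants.det A * Determinants.det (matrix_inv A) = 1"
    by (simp only: Determinants.det_mul)
  then have "\<bar>Determinants.det A\<bar> * \<bar>Determinants.det (matrix_inv A)\<bar> = 1"
    by (metis abs_mult abs_one)
  then have det: "\<bar>Determinants.det (matrix_inv A)\<bar> = 1 / \<bar>Determinants.det A\<bar>"
    by (auto simp: eq_divide_eq mult.commute)
  have "emeasure (distr (lebesgue_on \<Omega>) (lebesgue_on ((*v) A ` \<Omega>)) ((*v) A)) X
      = emeasure (lebesgue_on \<Omega>) ((*v) (matrix_inv A) ` X)"
    using matrix_vimage_eq_image[OF A X(1)] matrix_measurable_lebesgue_on[OF A \<Omega>] X_sets
    by (simp add: emeasure_distr)
  also have "\<dots> = emeasure lebesgue ((*v) (matrix_inv A) ` X)"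
    using X(1) matrix_inv_vector_mul[OF A] fmeasurableD[OF \<Omega>]
    by (intro emeasure_restrict_space) auto
  also have "\<dots> = ennreal (1 / \<bar>Determinants.det A\<bar> * measure lebesgue X)"
    using measure_linear_image[OF matrix_vector_mul_linear X(2), of "matrix_inv A"]
    by (simp only: emeasure_eq_measure2[OF linear_image_lmeasurable[OF X(2)]] matrix_of_matrix_vector_mul det)
  also have "\<dots> = ennreal (1 / \<bar>Determinants.det A\<bar>) * emeasure lebesgue X"
    by (simp add: emeasure_eq_measure2[OF X(2)] ennreal_mult[symmetric])
  also have "emeasure lebesgue X = emeasure (lebesgue_on ((*v) A ` \<Omega>)) X"
    using X(1) fmeasurableD[OF A\<Omega>] by (intro emeasure_restrict_space[symmetric]) auto
  finally show "emeasure (distr (lebesgue_on \<Omega>) (lebesgue_on ((*v) A ` \<Omega>)) ((*v) A)) X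
      = emeasure (density (lebesgue_on ((*v) A ` \<Omega>)) (\<lambda>_. ennreal (1 / \<bar>Determinants.det A\<bar>))) X"
    using X_sets by (simp add: emeasure_density_const)
qed simp

section \<open>Pull-back along an invertible matrix on a bounded open set\<close>

context
  fixes A :: "real^2^2" and \<Omega> :: "(real^2) set"
  assumes A: "invertible A" and \<Omega>: "open \<Omega>" "bounded \<Omega>"
begin

private lemma lmeas: "\<Omega> \<in> lmeasurable" "(*v) A ` \<Omega> \<in> lmeasurable"
  using \<Omega> linear_image_lmeasurable lmeasurable_open by blast+

private lemma sets_image: "\<Omega> \<in> sets lebesgue" "(*v) A ` \<Omega> \<in> sets lebesgue"
  using lmeas by auto

lemma open_matrix_image: "open ((*v) A ` \<Omega>)"
  using \<Omega>(1) A by (intro open_bijective_linear_image_eq[THEN iffD2]) (auto simp: invertible_eq_bij)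

lemma AE_compose_matrix:
  assumes "AE y in lebesgue_on ((*v) A ` \<Omega>). P y"
  shows "AE x in lebesgue_on \<Omega>. P (A *v x)"
proof (rule AE_distrD[OF matrix_measurable_lebesgue_on[OF A lmeas(1)]])
  show "AE y in distr (lebesgue_on \<Omega>) (lebesgue_on ((*v) A ` \<Omega>)) ((*v) A). P y"
    unfolding distr_lebesgue_on_matrix[OF A lmeas(1)]
    using assms by (subst AE_density) auto
qed

lemma measurable_compose_matrix:
  fixes f :: "real^2 \<Rightarrow> 'b::euclidean_space"
  assumes "f \<in> borel_measurable (lebesgue_on ((*v) A ` \<Omega>))"
  shows "(\<lambda>x. f (A *v x)) \<in> borel_measurable (lebesgue_on \<Omega>)"
  using measurable_compose[OF matrix_measurable_lebesgue_on[OF A lmeas(1)] assms] .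

lemma integrable_compose_matrix:
  fixes f :: "real^2 \<Rightarrow> 'b::euclidean_space"
  assumes "integrable (lebesgue_on ((*v) A ` \<Omega>)) f"
  shows "integrable (lebesgue_on \<Omega>) (\<lambda>x. f (A *v x))"
proof (rule integrable_distr[OF matrix_measurable_lebesgue_on[OF A lmeas(1)]])
  show "integrable (distr (lebesgue_on \<Omega>) (lebesgue_on ((*v) A ` \<Omega>)) ((*v) A)) f"
    unfolding distr_lebesgue_on_matrix[OF A lmeas(1)]
    using assms by (subst integrable_density) auto
qed

lemma integral_compose_matrix:
  fixes f :: "real^2 \<Rightarrow> 'b::euclidean_space"
  assumes "f \<in> borel_measurable (lebesgue_on ((*v) A ` \<Omega>))"
  shows "(\<integral>x. f (A *v x) \<partial>lebesgue_on \<Omega>)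
      = (1 / \<bar>Determinants.det A\<bar>) *\<^sub>R (\<integral>y. f y \<partial>lebesgue_on ((*v) A ` \<Omega>))"
proof -
  have "(\<integral>x. f (A *v x) \<partial>lebesgue_on \<Omega>)
      = (\<integral>y. f y \<partial>distr (lebesgue_on \<Omega>) (lebesgue_on ((*v) A ` \<Omega>)) ((*v) A))"
    by (rule integral_distr[OF matrix_measurable_lebesgue_on[OF A lmeas(1)] assms, symmetric])
  also have "\<dots> = (\<integral>y. (1 / \<bar>Determinants.det A\<bar>) *\<^sub>R f y \<partial>lebesgue_on ((*v) A ` \<Omega>))"
    unfolding distr_lebesgue_on_matrix[OF A lmeas(1)]
    using assms by (subst integral_density) auto
  finally show ?thesis
    by (simp only: integral_scaleR_right)
qed

lemma L2_compose_matrix: "f \<in> L2 ((*v) A ` \<Omega>) \<Longrightarrow> (\<lambda>x. f (A *v x)) \<in> L2 \<Omega>"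
  unfolding L2_def using measurable_compose_matrix[of f] integrable_compose_matrix[of "\<lambda>x. (norm (f x))\<^sup>2"] by auto

lemma l2_inner_compose_matrix:
  assumes "f \<in> L2 ((*v) A ` \<Omega>)" "g \<in> L2 ((*v) A ` \<Omega>)"
  shows "l2_inner \<Omega> (\<lambda>x. f (A *v x)) (\<lambda>x. g (A *v x))
      = 1 / \<bar>Determinants.det A\<bar> * l2_inner ((*v) A ` \<Omega>) f g"
  using integral_compose_matrix[of "\<lambda>x. f x \<bullet> g x"] L2_inner_integrable[OF assms]
  by (simp add: l2_inner_def)

text \<open>A test function \<open>\<psi>\<close> on \<open>\<Omega>\<close> is carried to
  \<open>\<psi>'\<close> on the image domain, where the defining identity of \<open>g\<close>
  applies. Going there and coming back produce the same Jacobian factor, which thus cancels.\<close>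

lemma is_weak_grad_compose_matrix:
  assumes u: "u \<in> L2 ((*v) A ` \<Omega>)" and g: "is_weak_grad ((*v) A ` \<Omega>) u g"
  shows "is_weak_grad \<Omega> (\<lambda>x. u (A *v x)) (\<lambda>x. Finite_Cartesian_Product.transpose A *v g (A *v x))"
  unfolding is_weak_grad_def
proof (intro conjI ballI allI)
  let ?At = "Finite_Cartesian_Product.transpose A" and ?B = "matrix_inv A"
  have g_L2: "g \<in> L2 ((*v) A ` \<Omega>)"
    using g by (rule is_weak_grad_L2)
  show "(\<lambda>x. ?At *v g (A *v x)) \<in> L2 \<Omega>"
    by (rule L2_bounded_linear[OF matrix_vector_mul_bounded_linear L2_compose_matrix[OF g_L2]])
  fix \<psi> i assume \<psi>: "\<psi> \<in> test_functions \<Omega>"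
  define \<psi>' where "\<psi>' y = \<psi> (?B *v y)" for y
  have B: "invertible ?B" "(*v) ?B ` ((*v) A ` \<Omega>) = \<Omega>"
    using matrix_inv_inverse[OF A] matrix_inv_vector_mul[OF A]
    by (auto simp: invertible_def image_image)
  have \<psi>': "\<psi>' \<in> test_functions ((*v) A ` \<Omega>)"
    unfolding \<psi>'_def using B \<psi> by (intro test_functions_compose_matrix) auto
  have \<psi>_eq: "\<psi>' (A *v x) = \<psi> x" for x
    by (simp add: \<psi>'_def matrix_inv_vector_mul[OF A])
  have comp: "(?At *v w) $ i = (\<Sum>j\<in>UNIV. A $ j $ i * w $ j)" for w :: "real^2"
    by (simp add: matrix_vector_mult_def Finite_Cartesian_Product.transpose_def)
  then have grad_eq: "grad \<psi> x $ i = (\<Sum>j\<in>UNIV. A $ j $ i * grad \<psi>' (A *v x) $ j)" for x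
    using grad_compose_matrix[OF \<psi>', where A = A and x = x] comp by (simp add: \<psi>_eq)
  have d_L2: "(\<lambda>y. grad \<psi>' y $ j) \<in> L2 ((*v) A ` \<Omega>)" for j
    using \<psi>' sets_image by (intro test_functions_L2 test_functions_grad)
  have "(\<integral>x. u (A *v x) * grad \<psi> x $ i \<partial>lebesgue_on \<Omega>)
      = l2_inner \<Omega> (\<lambda>x. \<Sum>j\<in>UNIV. A $ j $ i *\<^sub>R grad \<psi>' (A *v x) $ j) (\<lambda>x. u (A *v x))"
    by (simp add: l2_inner_def grad_eq mult.commute)
  also have "\<dots> = (\<Sum>j\<in>UNIV. A $ j $ i * l2_inner \<Omega> (\<lambda>x. grad \<psi>' (A *v x) $ j) (\<lambda>x. u (A *v x)))"
    by (intro l2_inner_sum_left L2_compose_matrix u d_L2 L2_compose_matrix[OF d_L2]) auto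
  also have "\<dots> = (\<Sum>j\<in>UNIV. A $ j $ i * (- l2_inner \<Omega> (\<lambda>x. g (A *v x) $ j) \<psi>))"
  proof (intro sum.cong refl arg_cong2[where f = "(*)"])
    fix j
    have "l2_inner \<Omega> (\<lambda>x. grad \<psi>' (A *v x) $ j) (\<lambda>x. u (A *v x))
        = 1 / \<bar>Determinants.det A\<bar> * (\<integral>y. u y * grad \<psi>' y $ j \<partial>lebesgue_on ((*v) A ` \<Omega>))"
      using l2_inner_compose_matrix[OF d_L2 u, of j] by (simp add: l2_inner_def mult.commute)
    also have "\<dots> = - (1 / \<bar>Determinants.det A\<bar> * l2_inner ((*v) A ` \<Omega>) (\<lambda>y. g y $ j) \<psi>')"
      using g \<psi>' by (simp add: is_weak_grad_def l2_inner_def)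
    also have "\<dots> = - l2_inner \<Omega> (\<lambda>x. g (A *v x) $ j) \<psi>"
      using l2_inner_compose_matrix[OF L2_nth[OF g_L2] test_functions_L2[OF \<psi>' sets_image(2)], of j]
      by (simp add: \<psi>_eq)
    finally show "l2_inner \<Omega> (\<lambda>x. grad \<psi>' (A *v x) $ j) (\<lambda>x. u (A *v x)) = - l2_inner \<Omega> (\<lambda>x. g (A *v x) $ j) \<psi>" .
  qed
  also have "\<dots> = - l2_inner \<Omega> (\<lambda>x. \<Sum>j\<in>UNIV. A $ j $ i *\<^sub>R g (A *v x) $ j) \<psi>"
    using l2_inner_sum_left[of UNIV "\<lambda>j x. g (A *v x) $ j" \<Omega> \<psi> "\<lambda>j. A $ j $ i"]
      L2_compose_matrix[OF L2_nth[OF g_L2]] test_functions_L2[OF \<psi> sets_image(1)]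
    by (simp add: sum_negf)
  also have "\<dots> = - (\<integral>x. (?At *v g (A *v x)) $ i * \<psi> x \<partial>lebesgue_on \<Omega>)"
    by (simp add: l2_inner_def comp del: transpose_matrix_vector)
  finally show "(\<integral>x. u (A *v x) * grad \<psi> x $ i \<partial>lebesgue_on \<Omega>)
      = - (\<integral>x. (?At *v g (A *v x)) $ i * \<psi> x \<partial>lebesgue_on \<Omega>)" .
qed

lemma H1_compose_matrix:
  assumes "u \<in> H1 ((*v) A ` \<Omega>)"
  shows "(\<lambda>x. u (A *v x)) \<in> H1 \<Omega>"
    and "AE x in lebesgue_on \<Omega>. weak_grad \<Omega> (\<lambda>x. u (A *v x)) x
      = Finite_Cartesian_Product.transpose A *v weak_grad ((*v) A ` \<Omega>) u (A *v x)"
  using is_weak_grad_compose_matrix[OF H1_L2 H1_weak_grad, OF assms assms]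
    weak_grad_AE[OF \<Omega>(1)] L2_compose_matrix[OF H1_L2[OF assms]]
  by (auto simp: H1_def)

text \<open>The approximating test functions are pulled back; both error norms grow at most by a
  constant depending on \<open>A\<close>.\<close>

lemma H10_compose_matrix:
  assumes u: "u \<in> H10 ((*v) A ` \<Omega>)"
  shows "(\<lambda>x. u (A *v x)) \<in> H10 \<Omega>"
proof -
  let ?\<Omega>' = "(*v) A ` \<Omega>" and ?At = "Finite_Cartesian_Product.transpose A"
  note uH1 = H10_H1[OF u]
  obtain \<phi> where \<phi>: "\<And>k. \<phi> k \<in> test_functions ?\<Omega>'"
    and lim: "(\<lambda>k. l2_norm ?\<Omega>' (\<lambda>x. \<phi> k x - u x)) \<longlonglongrightarrow> 0"
      "(\<lambda>k. l2_norm ?\<Omega>' (\<lambda>x. grad (\<phi> k) x - weak_grad ?\<Omega>' u x)) \<longlonglongrightarrow> 0"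
    using u unfolding H10_def by blast
  \<comment> \<open>The square root of the Jacobian factor, since \<open>l2_norm\<close> is the root
    of an integral.\<close>
  define c where "c = sqrt (1 / \<bar>Determinants.det A\<bar>)"
  have norm_compose: "l2_norm \<Omega> (\<lambda>x. f (A *v x)) = c * l2_norm ?\<Omega>' f" if "f \<in> L2 ?\<Omega>'" for f :: "real^2 \<Rightarrow> 'c::euclidean_space"
    using l2_inner_compose_matrix[OF that that] by (simp add: l2_norm_def c_def real_sqrt_mult[symmetric] del: real_sqrt_divide real_sqrt_abs)
  have "(\<lambda>x. \<phi> k x - u x) \<in> L2 ?\<Omega>'" for k
    by (rule L2_diff[OF test_functions_L2[OF \<phi> sets_image(2)] H1_L2[OF uH1]])
  from norm_compose[OF this]
  have "l2_norm \<Omega> (\<lambda>x. \<phi> k (A *v x) - u (A *v x)) = c * l2_norm ?\<Omega>' (\<lambda>x. \<phi> k x - u x)" for k .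
  then have 1: "(\<lambda>k. l2_norm \<Omega> (\<lambda>x. \<phi> k (A *v x) - u (A *v x))) \<longlonglongrightarrow> 0"
    using tendsto_mult_left[OF lim(1), of c] by simp
  obtain K where K: "\<And>v. norm (?At *v v) \<le> norm v * K"
    using bounded_linear.bounded[OF matrix_vector_mul_bounded_linear] by blast
  have bound: "l2_norm \<Omega> (\<lambda>x. grad (\<lambda>x. \<phi> k (A *v x)) x - weak_grad \<Omega> (\<lambda>x. u (A *v x)) x)
      \<le> \<bar>K\<bar> * c * l2_norm ?\<Omega>' (\<lambda>x. grad (\<phi> k) x - weak_grad ?\<Omega>' u x)" for k
  proof -
    define f where "f y = grad (\<phi> k) y - weak_grad ?\<Omega>' u y" for y
    have f: "f \<in> L2 ?\<Omega>'"
      unfolding f_def using \<phi> sets_image uH1 by (intro L2_diff test_functions_grad_L2 weak_grad_L2)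
    have f': "(\<lambda>x. f (A *v x)) \<in> L2 \<Omega>" and Af': "(\<lambda>x. ?At *v f (A *v x)) \<in> L2 \<Omega>"
      using L2_compose_matrix[OF f] L2_bounded_linear[OF matrix_vector_mul_bounded_linear] by blast+
    \<comment> \<open>The chosen weak gradient of the composite obeys the transformation rule only
      almost everywhere, which the norm cannot see.\<close>
    have ae: "AE x in lebesgue_on \<Omega>. grad (\<lambda>x. \<phi> k (A *v x)) x - weak_grad \<Omega> (\<lambda>x. u (A *v x)) x = ?At *v f (A *v x)"
      using H1_compose_matrix(2)[OF uH1]
      by eventually_elim (simp add: f_def grad_compose_matrix[OF \<phi>] matrix_vector_mult_diff_distrib)
    have "l2_norm \<Omega> (\<lambda>x. grad (\<lambda>x. \<phi> k (A *v x)) x - weak_grad \<Omega> (\<lambda>x. u (A *v x)) x)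
        = l2_norm \<Omega> (\<lambda>x. ?At *v f (A *v x))"
      unfolding l2_norm_def l2_inner_cong_AE[OF Af' Af' sets_image(1) ae ae] ..
    also have "\<dots> \<le> sqrt (K\<^sup>2 * l2_inner \<Omega> (\<lambda>x. f (A *v x)) (\<lambda>x. f (A *v x)))"
    proof -
      have "(\<integral>x. (?At *v f (A *v x)) \<bullet> (?At *v f (A *v x)) \<partial>lebesgue_on \<Omega>)
          \<le> (\<integral>x. K\<^sup>2 * (f (A *v x) \<bullet> f (A *v x)) \<partial>lebesgue_on \<Omega>)"
      proof (rule integral_mono)
        show "(?At *v f (A *v x)) \<bullet> (?At *v f (A *v x)) \<le> K\<^sup>2 * (f (A *v x) \<bullet> f (A *v x))" for x
          using power_mono[OF K[of "f (A *v x)"] norm_ge_zero, of 2]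
          by (simp add: power2_norm_eq_inner[symmetric] power_mult_distrib mult.commute)
      qed (use L2_inner_integrable[OF Af' Af'] L2_inner_integrable[OF f' f'] in auto)
      then show ?thesis
        by (simp add: l2_norm_def l2_inner_def)
    qed
    also have "\<dots> = \<bar>K\<bar> * l2_norm \<Omega> (\<lambda>x. f (A *v x))"
      by (simp add: l2_norm_def real_sqrt_mult)
    also have "\<dots> = \<bar>K\<bar> * c * l2_norm ?\<Omega>' f"
      by (simp add: norm_compose[OF f])
    finally show ?thesis
      unfolding f_def .
  qed
  have 2: "(\<lambda>k. l2_norm \<Omega> (\<lambda>x. grad (\<lambda>x. \<phi> k (A *v x)) x - weak_grad \<Omega> (\<lambda>x. u (A *v x)) x)) \<longlonglongrightarrow> 0"
  proof (rule tendsto_sandwich[OF _ _ tendsto_const])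
    show "(\<lambda>k. \<bar>K\<bar> * c * l2_norm ?\<Omega>' (\<lambda>x. grad (\<phi> k) x - weak_grad ?\<Omega>' u x)) \<longlonglongrightarrow> 0"
      using tendsto_mult_left[OF lim(2), of "\<bar>K\<bar> * c"] by simp
  qed (use bound in \<open>auto simp: l2_norm_def l2_inner_def\<close>)
  have "(\<lambda>x. \<phi> k (A *v x)) \<in> test_functions \<Omega>" for k
    using \<phi> A by (intro test_functions_compose_matrix)
  then show ?thesis
    using 1 2 H1_compose_matrix(1)[OF uH1] unfolding H10_def
    by (auto intro!: exI[of _ "\<lambda>k x. \<phi> k (A *v x)"])
qed

text \<open>Origin of the matrix in \<open>P_mat\<close>: pulling back multiplies gradients by the
  transpose of \<open>A\<close>. The factor \<open>matrix_inv A ** transpose (matrix_inv A)\<close>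
  undoes this in the first argument directly and in the second by adjunction.\<close>

lemma l2_inner_weak_grad_compose_matrix:
  assumes u: "u \<in> H1 ((*v) A ` \<Omega>)" and v: "v \<in> H1 ((*v) A ` \<Omega>)"
  shows "l2_inner \<Omega> (\<lambda>z. (matrix_inv A ** Finite_Cartesian_Product.transpose (matrix_inv A))
        *v weak_grad \<Omega> (\<lambda>x. u (A *v x)) z) (weak_grad \<Omega> (\<lambda>x. v (A *v x)))
      = 1 / \<bar>Determinants.det A\<bar>
        * l2_inner ((*v) A ` \<Omega>) (weak_grad ((*v) A ` \<Omega>) u) (weak_grad ((*v) A ` \<Omega>) v)"
proof -
  let ?At = "Finite_Cartesian_Product.transpose A" and ?B = "matrix_inv A"
  let ?Bt = "Finite_Cartesian_Product.transpose ?B" and ?\<Omega>' = "(*v) A ` \<Omega>"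
  have Bt: "?Bt *v (?At *v w) = w" for w
    by (simp only: matrix_vector_mul_assoc matrix_transpose_mul[symmetric] matrix_inv_inverse[OF A]
        transpose_mat matrix_vector_mul_lid)
  have "l2_inner \<Omega> (\<lambda>z. (?B ** ?Bt) *v weak_grad \<Omega> (\<lambda>x. u (A *v x)) z) (weak_grad \<Omega> (\<lambda>x. v (A *v x)))
      = l2_inner \<Omega> (\<lambda>z. ?B *v weak_grad ?\<Omega>' u (A *v z)) (\<lambda>z. ?At *v weak_grad ?\<Omega>' v (A *v z))"
  proof (rule l2_inner_cong_AE)
    show "AE z in lebesgue_on \<Omega>. (?B ** ?Bt) *v weak_grad \<Omega> (\<lambda>x. u (A *v x)) z = ?B *v weak_grad ?\<Omega>' u (A *v z)"
      using H1_compose_matrix(2)[OF u]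
      by eventually_elim (simp add: matrix_vector_mul_assoc[symmetric] Bt del: transpose_matrix_vector)
  qed (intro L2_bounded_linear[OF matrix_vector_mul_bounded_linear] L2_compose_matrix weak_grad_L2
        u v sets_image H1_compose_matrix(2))+
  also have "\<dots> = l2_inner \<Omega> (\<lambda>z. weak_grad ?\<Omega>' u (A *v z)) (\<lambda>z. weak_grad ?\<Omega>' v (A *v z))"
  proof -
    have "(?B *v w) \<bullet> (?At *v w') = w \<bullet> w'" for w w'
      using dot_lmul_matrix[of w' A "?B *v w"] matrix_inv_vector_mul[OF A]
      by (simp add: inner_commute)
    then show ?thesis
      by (simp add: l2_inner_def)
  qed
  also have "\<dots> = 1 / \<bar>Determinants.det A\<bar> * l2_inner ?\<Omega>' (weak_grad ?\<Omega>' u) (weak_grad ?\<Omega>' v)"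
    using u v by (intro l2_inner_compose_matrix weak_grad_L2)
  finally show ?thesis .
qed

end

section \<open>Matrix pencils\<close>

text \<open>Over polynomial matrices \<open>(M - z Q) X = Q X (diag d - z)\<close>. Taking
  determinants, the nonzero constant \<open>det X\<close> cancels, while \<open>det Q\<close>
  remains as a factor and may be zero.\<close>

lemma pencil_poly_diagonalized:
  fixes M Q X :: "real Matrix.mat"
  assumes carrier: "M \<in> carrier_mat m m" "Q \<in> carrier_mat m m" "X \<in> carrier_mat m m"
    and det: "Determinant.det X \<noteq> 0"
    and eq: "M * X = Q * X * mat_diag m d"
  shows "pencil_poly M Q = Polynomial.smult (Determinant.det Q) (\<Prod>i<m. [:d i, -1:])"
proof -
  let ?C = "map_mat (\<lambda>a. [:a:] :: real poly)"
  interpret C: comm_ring_hom "\<lambda>a. [:a:] :: real poly"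
    by unfold_locales auto
  let ?X = "?C X" and ?Q = "?C Q" and ?M = "?C M"
  let ?z = "[:0, 1:] :: real poly"
  let ?D = "mat_diag m (\<lambda>i. [:d i, -1:])"
  have c: "?X \<in> carrier_mat m m" "?Q \<in> carrier_mat m m" "?M \<in> carrier_mat m m" "?D \<in> carrier_mat m m"
    using carrier by auto
  have D: "?D = ?C (mat_diag m d) - ?z \<cdot>\<^sub>m 1\<^sub>m m"
  proof (rule eq_matI)
    fix i j assume "i < dim_row (?C (mat_diag m d) - ?z \<cdot>\<^sub>m 1\<^sub>m m)" "j < dim_col (?C (mat_diag m d) - ?z \<cdot>\<^sub>m 1\<^sub>m m)"
    moreover have "[:a, -1:] = [:a:] - ?z" for a :: real
      by (simp only: diff_pCons diff_0 minus_pCons minus_zero diff_zero)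
    ultimately show "?D $$ (i, j) = (?C (mat_diag m d) - ?z \<cdot>\<^sub>m 1\<^sub>m m) $$ (i, j)"
      by (simp only: mat_diag_def) simp
  qed (simp_all add: mat_diag_def)
  have QX: "?Q * ?X \<in> carrier_mat m m"
    using c(2,1) by (rule mult_carrier_mat)
  have "(?M - ?z \<cdot>\<^sub>m ?Q) * ?X = ?M * ?X - ?z \<cdot>\<^sub>m (?Q * ?X)"
    by (simp only: minus_mult_distrib_mat[OF c(3) smult_carrier_mat[OF c(2)] c(1)] mult_smult_assoc_mat[OF c(2,1)])
  also have "?M * ?X = ?Q * ?X * ?C (mat_diag m d)"
    using arg_cong[OF eq, of ?C]
    by (simp only: C.mat_hom_mult[OF carrier(1,3)] C.mat_hom_mult[OF carrier(2,3)]
        C.mat_hom_mult[OF mult_carrier_mat[OF carrier(2,3)] mat_diag_dim])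
  also have "\<dots> - ?z \<cdot>\<^sub>m (?Q * ?X) = ?Q * ?X * ?D"
    unfolding D
    by (simp only: mult_minus_distrib_mat[OF QX map_carrier_mat[THEN iffD2, OF mat_diag_dim] smult_carrier_mat[OF one_carrier_mat]]
        mult_smult_distrib[OF QX one_carrier_mat] right_mult_one_mat[OF QX])
  finally have "Determinant.det ((?M - ?z \<cdot>\<^sub>m ?Q) * ?X) = Determinant.det (?Q * ?X * ?D)"
    by simp
  then have "Determinant.det (?M - ?z \<cdot>\<^sub>m ?Q) * Determinant.det ?X
      = Determinant.det ?Q * Determinant.det ?D * Determinant.det ?X"
    using Determinant.det_mult[OF minus_carrier_mat[OF smult_carrier_mat[OF c(2)]] c(1)]
      Determinant.det_mult[OF QX c(4)] Determinant.det_mult[OF c(2,1)]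
    by (simp only: mult.commute mult.left_commute)
  moreover have "Determinant.det ?X \<noteq> 0"
    using det by (simp add: C.hom_det)
  ultimately have "pencil_poly M Q = Determinant.det ?Q * Determinant.det ?D"
    unfolding pencil_poly_def by (metis mult_right_cancel)
  moreover have "Determinant.det ?D = prod_list (map (\<lambda>i. [:d i, -1:]) [0..<m])"
    by (subst det_upper_triangular[OF _ c(4)]) (auto simp: mat_diag_def diag_mat_def intro!: arg_cong[where f = prod_list])
  moreover have "\<dots> = (\<Prod>i<m. [:d i, -1:])"
    using prod.distinct_set_conv_list[of "[0..<m]" "\<lambda>i. [:d i, -1:]"] by (simp add: lessThan_atLeast0)
  ultimately show ?thesis
    by (simp add: C.hom_det)
qed

text \<open>Regularity forces \<open>det Q\<close> to be nonzero in the factorization, and a nonzero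
  constant leaves the multiset of roots unchanged.\<close>

lemma pencil_eigenvalues_diagonalized:
  fixes M Q X :: "real Matrix.mat"
  assumes carrier: "M \<in> carrier_mat m m" "Q \<in> carrier_mat m m" "X \<in> carrier_mat m m"
    and det: "Determinant.det X \<noteq> 0"
    and eq: "M * X = Q * X * mat_diag m d"
    and mono: "\<And>i j. i \<le> j \<Longrightarrow> j < m \<Longrightarrow> d i \<le> d j"
    and regular: "regular_pencil M Q"
  shows "pencil_eigenvalues M Q = map d [0..<m]"
proof -
  have "proots [:d i, -1:] = {#d i#}" for i
  proof -
    have "[:d i, -1:] = - [:- d i, 1:]"
      by simp
    then show ?thesis
      by (simp only: proots_uminus proots_linear_factor minus_minus)
  qed
  moreover have "(\<Sum>i<m. {#d i#}) = mset (map d [0..<m])"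
    by (induction m) auto
  ultimately have roots: "proots (\<Prod>i<m. [:d i, -1:]) = mset (map d [0..<m])"
    by (simp add: proots_prod)
  have "pencil_poly M Q = Polynomial.smult (Determinant.det Q) (\<Prod>i<m. [:d i, -1:])"
    using carrier det eq by (rule pencil_poly_diagonalized)
  moreover have "Determinant.det Q \<noteq> 0"
    using calculation regular by (auto simp: regular_pencil_def)
  ultimately have "proots (pencil_poly M Q) = mset (map d [0..<m])"
    by (simp only: proots_smult[OF \<open>Determinant.det Q \<noteq> 0\<close>] roots)
  moreover have "sorted (map d [0..<m])"
    by (auto simp: sorted_iff_nth_mono intro: mono)
  ultimately show ?thesis
    unfolding pencil_eigenvalues_def by (simp only: sorted_list_of_multiset_mset sorted_sort_id)
qed

section \<open>Eigenvalue quotients\<close>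

text \<open>Separates the two terms that are evaluated by two different equations: the one on the
  transformed domain and the one on \<open>\<Omega>\<close>.\<close>

lemma F_form_P_mat:
  assumes u: "u \<in> H1 \<Omega>" and v: "v \<in> H1 \<Omega>"
  shows "F_form \<Omega> (P_mat t S) u v
    = (l2_inner \<Omega> (\<lambda>z. (matrix_inv S ** Finite_Cartesian_Product.transpose (matrix_inv S)) *v weak_grad \<Omega> u z)
          (weak_grad \<Omega> v)
        - l2_inner \<Omega> (weak_grad \<Omega> u) (weak_grad \<Omega> v)) / t"
proof -
  let ?B = "matrix_inv S ** Finite_Cartesian_Product.transpose (matrix_inv S)"
  have "P_mat t S *v w = (1 / t) *\<^sub>R (?B *v w - w)" for w
    by (simp add: P_mat_def scaleR_matrix_vector_assoc[symmetric] matrix_vector_mult_diff_rdistrib)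
  then have "F_form \<Omega> (P_mat t S) u v
      = (1 / t) * l2_inner \<Omega> (\<lambda>z. ?B *v weak_grad \<Omega> u z - weak_grad \<Omega> u z) (weak_grad \<Omega> v)"
    by (simp only: F_form_def l2_inner_scaleR_left)
  also have "l2_inner \<Omega> (\<lambda>z. ?B *v weak_grad \<Omega> u z - weak_grad \<Omega> u z) (weak_grad \<Omega> v)
      = l2_inner \<Omega> (\<lambda>z. ?B *v weak_grad \<Omega> u z) (weak_grad \<Omega> v) - l2_inner \<Omega> (weak_grad \<Omega> u) (weak_grad \<Omega> v)"
    using u v by (intro l2_inner_diff_left L2_bounded_linear[OF matrix_vector_mul_bounded_linear] weak_grad_L2)
  finally show ?thesis
    by simp
qed

text \<open>Each function is the test function in the other's equation: \<open>\<phi>\<close>,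
  transported to \<open>w\<close>, in the one for \<open>u\<close>, and the pull-back of
  \<open>u\<close> in the one for \<open>\<phi>\<close>.\<close>

lemma F_form_eigenspaces:
  assumes S: "invertible S" and \<Omega>: "open \<Omega>" "bounded \<Omega>"
    and u: "u \<in> eigenspace ((*v) S ` \<Omega>) \<mu>" and \<phi>: "\<phi> \<in> eigenspace \<Omega> \<nu>"
  shows "F_form \<Omega> (P_mat t S) (\<lambda>z. u (S *v z)) \<phi> = (\<mu> - \<nu>) / t * l2_inner \<Omega> (\<lambda>z. u (S *v z)) \<phi>"
proof -
  let ?\<Omega>' = "(*v) S ` \<Omega>" and ?ut = "\<lambda>z. u (S *v z)"
  define w where "w y = \<phi> (matrix_inv S *v y)" for y
  have u': "u \<in> H10 ?\<Omega>'" and \<phi>': "\<phi> \<in> H10 \<Omega>"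
    using u \<phi> by (simp_all add: eigenspace_def)
  have ut: "?ut \<in> H10 \<Omega>"
    using S \<Omega> u' by (rule H10_compose_matrix)
  have \<phi>_eq: "\<phi> = (\<lambda>z. w (S *v z))"
    by (simp add: w_def matrix_inv_vector_mul[OF S])
  have w: "w \<in> H10 ?\<Omega>'"
    unfolding w_def
  proof (rule H10_compose_matrix)
    show "invertible (matrix_inv S)"
      using matrix_inv_inverse[OF S] unfolding invertible_def by blast
    show "open ?\<Omega>'"
      using S \<Omega> by (rule open_matrix_image)
    show "bounded ?\<Omega>'"
      using \<Omega>(2) matrix_vector_mul_bounded_linear by (rule bounded_linear_image)
    have "(*v) (matrix_inv S) ` ?\<Omega>' = \<Omega>"
      by (simp add: image_image matrix_inv_vector_mul[OF S])
    then show "\<phi> \<in> H10 ((*v) (matrix_inv S) ` ?\<Omega>')"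
      using \<phi>' by simp
  qed
  have "l2_inner \<Omega> (\<lambda>z. (matrix_inv S ** Finite_Cartesian_Product.transpose (matrix_inv S)) *v weak_grad \<Omega> ?ut z)
        (weak_grad \<Omega> \<phi>)
      = 1 / \<bar>Determinants.det S\<bar> * l2_inner ?\<Omega>' (weak_grad ?\<Omega>' u) (weak_grad ?\<Omega>' w)"
    unfolding \<phi>_eq by (rule l2_inner_weak_grad_compose_matrix[OF S \<Omega> H10_H1[OF u'] H10_H1[OF w]])
  also have "\<dots> = \<mu> * (1 / \<bar>Determinants.det S\<bar> * l2_inner ?\<Omega>' u w)"
    using u w by (simp add: eigenspace_def)
  also have "1 / \<bar>Determinants.det S\<bar> * l2_inner ?\<Omega>' u w = l2_inner \<Omega> ?ut \<phi>"
    unfolding \<phi>_eq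
    by (rule l2_inner_compose_matrix[OF S \<Omega> H1_L2[OF H10_H1[OF u']] H1_L2[OF H10_H1[OF w]], symmetric])
  finally have 1: "l2_inner \<Omega> (\<lambda>z. (matrix_inv S ** Finite_Cartesian_Product.transpose (matrix_inv S)) *v weak_grad \<Omega> ?ut z)
        (weak_grad \<Omega> \<phi>) = \<mu> * l2_inner \<Omega> ?ut \<phi>" .
  have 2: "l2_inner \<Omega> (weak_grad \<Omega> ?ut) (weak_grad \<Omega> \<phi>) = \<nu> * l2_inner \<Omega> ?ut \<phi>"
    using \<phi> ut unfolding eigenspace_def by (simp add: l2_inner_commute[of \<Omega> _ "weak_grad \<Omega> \<phi>"] l2_inner_commute[of \<Omega> _ \<phi>])
  show ?thesis
    unfolding F_form_P_mat[OF H10_H1[OF ut] H10_H1[OF \<phi>']] 1 2 by (simp add: left_diff_distrib)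
qed

text \<open>The chosen gradients are linear only up to null sets, but \<open>F_form\<close> sees
  them only under an integral.\<close>

lemma F_form_linear_comb:
  assumes \<Omega>: "open \<Omega>" and I: "finite I" and u: "\<And>i. i \<in> I \<Longrightarrow> u i \<in> H1 \<Omega>" and w: "w \<in> H1 \<Omega>"
    and v: "AE x in lebesgue_on \<Omega>. v x = (\<Sum>i\<in>I. c i * u i x)"
  shows "F_form \<Omega> P v w = (\<Sum>i\<in>I. c i * F_form \<Omega> P (u i) w)"
proof -
  have \<Omega>_sets: "\<Omega> \<in> sets lebesgue"
    using \<Omega> by auto
  have L2: "(\<lambda>x. P *v weak_grad \<Omega> (u i) x) \<in> L2 \<Omega>" if "i \<in> I" for i
    using u[OF that] by (intro L2_bounded_linear[OF matrix_vector_mul_bounded_linear] weak_grad_L2)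
  have ae: "AE x in lebesgue_on \<Omega>. P *v weak_grad \<Omega> v x = (\<Sum>i\<in>I. c i *\<^sub>R (P *v weak_grad \<Omega> (u i) x))"
  proof -
    have "AE x in lebesgue_on \<Omega>. weak_grad \<Omega> v x = (\<Sum>i\<in>I. c i *\<^sub>R weak_grad \<Omega> (u i) x)"
      using u by (intro H1_linear_comb(2)[OF \<Omega> I _ v])
    then show ?thesis
      by eventually_elim (simp add: linear_sum[OF matrix_vector_mul_linear] matrix_vector_mult_scaleR)
  qed
  have "F_form \<Omega> P v w = l2_inner \<Omega> (\<lambda>x. \<Sum>i\<in>I. c i *\<^sub>R (P *v weak_grad \<Omega> (u i) x)) (weak_grad \<Omega> w)"
    unfolding F_form_def
    by (rule l2_inner_cong_AE[OF L2_linear_comb[OF I L2] weak_grad_L2[OF w] \<Omega>_sets ae AE_I2]) auto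
  also have "\<dots> = (\<Sum>i\<in>I. c i * F_form \<Omega> P (u i) w)"
    unfolding F_form_def by (rule l2_inner_sum_left[OF I L2 weak_grad_L2[OF w]])
  finally show ?thesis .
qed

lemma l2_inner_linear_comb:
  assumes \<Omega>: "\<Omega> \<in> sets lebesgue" and I: "finite I" and u: "\<And>i. i \<in> I \<Longrightarrow> u i \<in> L2 \<Omega>" and w: "w \<in> L2 \<Omega>"
    and v: "AE x in lebesgue_on \<Omega>. v x = (\<Sum>i\<in>I. c i * u i x)"
  shows "l2_inner \<Omega> v w = (\<Sum>i\<in>I. c i * l2_inner \<Omega> (u i) w)"
proof -
  have ae: "AE x in lebesgue_on \<Omega>. v x = (\<Sum>i\<in>I. c i *\<^sub>R u i x)"
    using v by simp
  have "l2_inner \<Omega> v w = l2_inner \<Omega> (\<lambda>x. \<Sum>i\<in>I. c i *\<^sub>R u i x) w"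
    by (rule l2_inner_cong_AE[OF L2_linear_comb[OF I u] w \<Omega> ae AE_I2]) auto
  then show ?thesis
    by (simp only: l2_inner_sum_left[OF I u w])
qed

section \<open>Coordinates modulo null sets\<close>

lemma in_span_ae:
  assumes "finite I" "i \<in> I"
  shows "w i \<in> span_ae \<Omega> I w"
  unfolding span_ae_def using assms
  by (auto intro!: exI[of _ "\<lambda>j. if j = i then 1 else 0"] simp: if_distrib[of "\<lambda>c. c * _"] sum.delta cong: if_cong)

lemma lin_indep_ae_nonzero:
  assumes "lin_indep_ae \<Omega> I w" "finite I" "i \<in> I"
  shows "\<not> (AE z in lebesgue_on \<Omega>. w i z = 0)"
proof
  assume "AE z in lebesgue_on \<Omega>. w i z = 0"
  then have "AE z in lebesgue_on \<Omega>. (\<Sum>j\<in>I. (if j = i then 1 else 0) * w j z) = 0"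
    using assms by (simp add: if_distrib[of "\<lambda>c. c * _"] sum.delta cong: if_cong)
  then show False
    using assms unfolding lin_indep_ae_def by fastforce
qed

lemma sum_atLeastAtMost_shift:
  fixes f :: "nat \<Rightarrow> 'a::comm_monoid_add"
  assumes "n \<le> N"
  shows "(\<Sum>j\<in>{n..N}. f j) = (\<Sum>j<N - n + 1. f (n + j))"
  by (rule sum.reindex_bij_witness[of _ "\<lambda>j. n + j" "\<lambda>j. j - n"]) (use assms in auto)

text \<open>A kernel vector of the coordinate matrix would be the coefficient vector of a nontrivial
  linear relation among the \<open>w i\<close>.\<close>

lemma det_coordinates_nonzero:
  assumes indep: "lin_indep_ae \<Omega> {n..N} w" and nN: "n \<le> N" and m: "m = N - n + 1"
    and coord: "\<And>i. i \<in> {n..N} \<Longrightarrow> AE z in lebesgue_on \<Omega>. w i z = (\<Sum>j\<in>{n..N}. s j i * b j z)"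
  shows "Determinant.det (Matrix.mat m m (\<lambda>(j, i). s (n + j) (n + i))) \<noteq> (0::real)"
proof
  let ?X = "Matrix.mat m m (\<lambda>(j, i). s (n + j) (n + i))"
  assume "Determinant.det ?X = 0"
  then obtain v where v: "v \<in> carrier_vec m" "v \<noteq> 0\<^sub>v m" "?X *\<^sub>v v = 0\<^sub>v m"
    using det_0_iff_vec_prod_zero[of ?X m] by auto
  define c where "c i = vec_index v (i - n)" for i
  have Xv: "(\<Sum>i\<in>{n..N}. s j i * c i) = 0" if j: "j \<in> {n..N}" for j
  proof -
    have jm: "j - n < m" "n + (j - n) = j"
      using j m nN by auto
    have "vec_index (?X *\<^sub>v v) (j - n) = 0"
      using v(3) jm by simp
    moreover have "vec_index (?X *\<^sub>v v) (j - n) = (\<Sum>i<m. s j (n + i) * c (n + i))"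
      using v(1) jm by (simp add: scalar_prod_def c_def lessThan_atLeast0)
    ultimately show ?thesis
      using sum_atLeastAtMost_shift[OF nN, of "\<lambda>i. s j i * c i"] m by simp
  qed
  \<comment> \<open>Finitely many expansions share one exceptional null set.\<close>
  have "AE z in lebesgue_on \<Omega>. \<forall>i\<in>{n..N}. w i z = (\<Sum>j\<in>{n..N}. s j i * b j z)"
    using coord by (intro AE_finite_allI) auto
  then have "AE z in lebesgue_on \<Omega>. (\<Sum>i\<in>{n..N}. c i * w i z) = 0"
  proof eventually_elim
    case (elim z)
    then have "(\<Sum>i\<in>{n..N}. c i * w i z) = (\<Sum>i\<in>{n..N}. \<Sum>j\<in>{n..N}. s j i * c i * b j z)"
      by (simp add: sum_distrib_left mult.assoc mult.left_commute)
    also have "\<dots> = (\<Sum>j\<in>{n..N}. (\<Sum>i\<in>{n..N}. s j i * c i) * b j z)"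
      by (subst sum.swap) (simp add: sum_distrib_right)
    finally show ?case
      by (simp add: Xv)
  qed
  then have "\<forall>i\<in>{n..N}. c i = 0"
    using indep unfolding lin_indep_ae_def by blast
  then have "vec_index v i = 0" if "i < m" for i
    using that m nN unfolding c_def by (auto dest!: bspec[of _ _ "n + i"])
  then have "v = 0\<^sub>v m"
    using v(1) by (intro eq_vecI) auto
  with v(2) show False
    by contradiction
qed

section \<open>Triangles and the linear map between them\<close>

lemma open_tri: "open (tri p)"
  by (simp add: tri_def)

lemma bounded_tri: "bounded (tri p)"
  unfolding tri_def by (intro bounded_interior finite_imp_bounded_convex_hull) simp

lemma invertible_tri_map: "p $ 2 \<noteq> 0 \<Longrightarrow> q $ 2 \<noteq> 0 \<Longrightarrow> invertible (tri_map p q)"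
  by (simp add: invertible_det_nz det_2 tri_map_def)

text \<open>Bijective linear maps commute with interior and convex hull, so only the three vertices
  have to be followed.\<close>

lemma tri_map_image:
  assumes "p $ 2 \<noteq> 0" "q $ 2 \<noteq> 0"
  shows "(*v) (tri_map p q) ` tri p = tri q"
proof -
  have "bij ((*v) (tri_map p q))"
    using invertible_tri_map[OF assms] by (simp add: invertible_eq_bij)
  then have "(*v) (tri_map p q) ` tri p = interior ((*v) (tri_map p q) ` (convex hull {vector [0, 0], vector [1, 0], p}))"
    unfolding tri_def by (intro interior_bijective_linear_image[symmetric]) auto
  also have "(*v) (tri_map p q) ` (convex hull {vector [0, 0], vector [1, 0], p})
      = convex hull ((*v) (tri_map p q) ` {vector [0, 0], vector [1, 0], p})"
    by (intro convex_hull_linear_image) simp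
  also have "(*v) (tri_map p q) ` {vector [0, 0], vector [1, 0], p} = {vector [0, 0], vector [1, 0], q}"
  proof -
    have "tri_map p q *v vector [0, 0] = vector [0, 0]" "tri_map p q *v vector [1, 0] = vector [1, 0]"
      "tri_map p q *v p = q"
      using assms by (simp_all add: tri_map_def Finite_Cartesian_Product.vec_eq_iff forall_2 matrix_vector_mult_def sum_2)
    then show ?thesis
      by simp
  qed
  finally show ?thesis
    by (simp add: tri_def)
qed

theorem theorem3p2:
  fixes p e q :: "real^2"
    and t lam :: real
    and lam0 lamt D :: "nat \<Rightarrow> real"
    and n N m :: nat
    and S P :: "real^2^2"
    and T0 Tt :: "(real^2) set"
    and E Et :: "(real^2 \<Rightarrow> real) set"
    and u ut \<phi> \<phi>t :: "nat \<Rightarrow> real^2 \<Rightarrow> real"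
    and Mt Nt :: "real Matrix.mat"
  assumes t: "t > 0" and e: "norm e = 1" and q: "q = p + t *\<^sub>R e"
    and nondeg: "p $ 2 \<noteq> 0" "q $ 2 \<noteq> 0"
    and T0: "T0 = tri p" and Tt: "Tt = tri q"
    and lam0: "dirichlet_eigenvalues T0 lam0"
    and lamt: "dirichlet_eigenvalues Tt lamt"
    and nN: "1 \<le> n" "n \<le> N"
    and cluster: "\<And>i. i \<in> {n..N} \<Longrightarrow> lam0 i = lam"
    and E: "E = eigenspace T0 lam"
    and u_eig: "\<And>i. i \<in> {n..N} \<Longrightarrow> is_eigenfunction Tt (lamt i) (u i)"
    and u_indep: "lin_indep_ae Tt {n..N} u"
    and S: "S = tri_map p q"
    and ut: "\<And>i. ut i = (\<lambda>z. u i (S *v z))"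
    and Et: "Et = span_ae T0 {n..N} ut"
    and D: "\<And>i. D i = (lamt i - lam) / t"
    and P: "P = P_mat t S"
    and dim: "\<exists>d. has_dim_ae T0 Et d \<and> has_dim_ae T0 E d"
    and basis_Et: "is_basis_ae T0 Et {n..N} \<phi>t"
    and basis_E: "is_basis_ae T0 E {n..N} \<phi>"
    and m: "m = N - n + 1"
    and Mt: "Mt = Matrix.mat m m (\<lambda>(j, i). F_form T0 P (\<phi>t (n + i)) (\<phi> (n + j)))"
    and Nt: "Nt = Matrix.mat m m (\<lambda>(j, i). l2_inner T0 (\<phi>t (n + i)) (\<phi> (n + j)))"
  shows "(\<forall>i\<in>{n..N}. \<forall>j\<in>{n..N}. i \<le> j \<longrightarrow> D i \<le> D j) \<and>
    (regular_pencil Mt Nt \<longrightarrow>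
      (\<forall>i\<in>{n..N}. is_kth_pencil_eigenvalue Mt Nt (i - n + 1) (D i))) \<and>
    (\<exists>s :: nat \<Rightarrow> nat \<Rightarrow> real.
      Determinant.det (Matrix.mat m m (\<lambda>(j, i). s (n + j) (n + i))) \<noteq> 0 \<and>
      (\<forall>i\<in>{n..N}.
        ut i \<in> Et \<and>
        (AE z in lebesgue_on T0. ut i z = (\<Sum>j\<in>{n..N}. s j i * \<phi>t j z)) \<and>
        pencil_eigenvector Mt Nt (D i) (Matrix.vec m (\<lambda>j. s (n + j) i))))"
proof -
  let ?I = "{n..N}"
  have T0_props: "open T0" "bounded T0" "T0 \<in> sets lebesgue"
    unfolding T0 using open_tri bounded_tri by auto
  have S_inv: "invertible S" and S_img: "(*v) S ` T0 = Tt"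
    unfolding S T0 Tt using invertible_tri_map tri_map_image nondeg by blast+
  have idx: "n + j \<in> ?I" if "j < m" for j
    using that m nN by auto
  have shift: "(\<Sum>j\<in>?I. f j) = (\<Sum>j<m. f (n + j))" for f :: "nat \<Rightarrow> real"
    unfolding m by (rule sum_atLeastAtMost_shift[OF nN(2)])

  have u: "u i \<in> eigenspace ((*v) S ` T0) (lamt i)" if "i \<in> ?I" for i
    using u_eig[OF that] unfolding S_img is_eigenfunction_def by blast
  have ut_H1: "ut i \<in> H1 T0" if "i \<in> ?I" for i
    using u[OF that] unfolding ut eigenspace_def
    by (auto intro: H1_compose_matrix(1)[OF S_inv T0_props(1,2)] H10_H1)
  \<comment> \<open>A relation among the \<open>ut i\<close> on \<open>T0\<close> is carried back to
    \<open>Tt\<close> by the inverse of \<open>S\<close>, which preserves null sets.\<close>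
  have ut_indep: "lin_indep_ae T0 ?I ut"
    unfolding lin_indep_ae_def
  proof (intro allI impI)
    fix c assume ae: "AE z in lebesgue_on T0. (\<Sum>i\<in>?I. c i * ut i z) = 0"
    have "AE y in lebesgue_on Tt. (\<Sum>i\<in>?I. c i * ut i (matrix_inv S *v y)) = 0"
    proof (rule AE_compose_matrix)
      show "invertible (matrix_inv S)"
        using matrix_inv_inverse[OF S_inv] unfolding invertible_def by blast
      show "open Tt" "bounded Tt"
        unfolding Tt by (rule open_tri bounded_tri)+
      have img: "(*v) (matrix_inv S) ` Tt = T0"
        unfolding S_img[symmetric] by (simp add: image_image matrix_inv_vector_mul[OF S_inv])
      show "AE z in lebesgue_on ((*v) (matrix_inv S) ` Tt). (\<Sum>i\<in>?I. c i * ut i z) = 0"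
        unfolding img by (rule ae)
    qed
    then have "AE y in lebesgue_on Tt. (\<Sum>i\<in>?I. c i * u i y) = 0"
      by (simp add: ut matrix_inv_vector_mul[OF S_inv])
    then show "\<forall>i\<in>?I. c i = 0"
      using u_indep unfolding lin_indep_ae_def by blast
  qed

  have ut_Et: "ut i \<in> Et" if "i \<in> ?I" for i
    unfolding Et using that by (intro in_span_ae) auto
  have "\<forall>i\<in>?I. \<exists>c. AE z in lebesgue_on T0. ut i z = (\<Sum>j\<in>?I. c j * \<phi>t j z)"
    using ut_Et basis_Et unfolding is_basis_ae_def span_ae_def by blast
  then obtain c where c: "\<And>i. i \<in> ?I \<Longrightarrow> AE z in lebesgue_on T0. ut i z = (\<Sum>j\<in>?I. c i j * \<phi>t j z)"
    by metis
  \<comment> \<open>The indices are swapped so that column \<open>i\<close> of \<open>s\<close>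
    holds the coordinates of \<open>ut i\<close>.\<close>
  define s where "s j i = c i j" for j i
  have s: "AE z in lebesgue_on T0. ut i z = (\<Sum>j\<in>?I. s j i * \<phi>t j z)" if "i \<in> ?I" for i
    unfolding s_def by (rule c[OF that])
  \<comment> \<open>\<open>\<phi>t\<close> is an arbitrary basis of \<open>Et\<close>; its
    regularity comes from expanding it in the \<open>ut i\<close>.\<close>
  have \<phi>t_H1: "\<phi>t j \<in> H1 T0" if "j \<in> ?I" for j
  proof -
    have "\<phi>t j \<in> Et"
      using basis_Et in_span_ae[of ?I j \<phi>t T0] that unfolding is_basis_ae_def by simp
    then obtain d where d: "AE z in lebesgue_on T0. \<phi>t j z = (\<Sum>i\<in>?I. d i * ut i z)"
      unfolding Et span_ae_def by blast
    show ?thesis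
      by (rule H1_linear_comb(1)[OF T0_props(1) _ ut_H1 d]) auto
  qed
  have \<phi>_E: "\<phi> k \<in> eigenspace T0 lam" if "k \<in> ?I" for k
    using basis_E in_span_ae[of ?I k \<phi> T0] that unfolding is_basis_ae_def E by simp
  have \<phi>_H1: "\<phi> k \<in> H1 T0" if "k \<in> ?I" for k
    using \<phi>_E[OF that] H10_H1 unfolding eigenspace_def by blast

  \<comment> \<open>Row \<open>k\<close> of the matrix equation for column \<open>i\<close> of
    \<open>s\<close>: both forms are evaluated at \<open>ut i\<close> and expanded in
    \<open>\<phi>t\<close>.\<close>
  have pencil: "(\<Sum>j<m. F_form T0 P (\<phi>t (n + j)) (\<phi> (n + k)) * s (n + j) i)
      = D i * (\<Sum>j<m. l2_inner T0 (\<phi>t (n + j)) (\<phi> (n + k)) * s (n + j) i)"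
    if i: "i \<in> ?I" and k: "k < m" for i k
  proof -
    note \<phi>k = \<phi>_H1[OF idx[OF k]]
    have "(\<Sum>j\<in>?I. s j i * F_form T0 P (\<phi>t j) (\<phi> (n + k))) = F_form T0 P (ut i) (\<phi> (n + k))"
      using F_form_linear_comb[OF T0_props(1) _ \<phi>t_H1 \<phi>k s[OF i]] by simp
    also have "\<dots> = D i * l2_inner T0 (ut i) (\<phi> (n + k))"
      unfolding P ut D by (rule F_form_eigenspaces[OF S_inv T0_props(1,2) u[OF i] \<phi>_E[OF idx[OF k]]])
    also have "l2_inner T0 (ut i) (\<phi> (n + k)) = (\<Sum>j\<in>?I. s j i * l2_inner T0 (\<phi>t j) (\<phi> (n + k)))"
      using l2_inner_linear_comb[OF T0_props(3) _ H1_L2[OF \<phi>t_H1] H1_L2[OF \<phi>k] s[OF i]] by simp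
    finally show ?thesis
      by (simp add: shift mult.commute)
  qed

  let ?X = "Matrix.mat m m (\<lambda>(j, i). s (n + j) (n + i))"
  have Mt_carrier: "Mt \<in> carrier_mat m m" and Nt_carrier: "Nt \<in> carrier_mat m m"
    by (simp_all add: Mt Nt)
  have det: "Determinant.det ?X \<noteq> 0"
    using ut_indep nN(2) m s by (rule det_coordinates_nonzero)
  have mono: "D i \<le> D j" if "i \<in> ?I" "j \<in> ?I" "i \<le> j" for i j
  proof -
    \<comment> \<open>\<open>lamt\<close> is ordered only from index 1 on, and
      \<open>1 \<le> n\<close> keeps the cluster in that range.\<close>
    have "lamt i \<le> lamt j"
      using lamt that nN unfolding dirichlet_eigenvalues_def by auto
    then show ?thesis
      using t by (simp add: D divide_right_mono)
  qed

  have kth: "is_kth_pencil_eigenvalue Mt Nt (i - n + 1) (D i)" if reg: "regular_pencil Mt Nt" and i: "i \<in> ?I" for i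
  proof -
    \<comment> \<open>All the column equations at once: a diagonal factor on the right scales column
      \<open>i\<close> by \<open>D (n + i)\<close>.\<close>
    have "Mt * ?X = Nt * ?X * mat_diag m (\<lambda>i. D (n + i))"
    proof (rule eq_matI)
      fix k i assume "k < dim_row (Nt * ?X * mat_diag m (\<lambda>i. D (n + i)))" "i < dim_col (Nt * ?X * mat_diag m (\<lambda>i. D (n + i)))"
      then have ki: "k < m" "i < m"
        by (simp_all add: Nt mat_diag_def)
      have "(Mt * ?X) $$ (k, i) = (\<Sum>j<m. F_form T0 P (\<phi>t (n + j)) (\<phi> (n + k)) * s (n + j) (n + i))"
        using ki by (simp add: Mt scalar_prod_def lessThan_atLeast0)
      moreover have "(Nt * ?X) $$ (k, i) = (\<Sum>j<m. l2_inner T0 (\<phi>t (n + j)) (\<phi> (n + k)) * s (n + j) (n + i))"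
        using ki by (simp add: Nt scalar_prod_def lessThan_atLeast0)
      moreover have "(Nt * ?X * mat_diag m (\<lambda>i. D (n + i))) $$ (k, i) = (Nt * ?X) $$ (k, i) * D (n + i)"
        using ki by (subst mat_diag_mult_right[OF mult_carrier_mat[OF Nt_carrier]]) auto
      ultimately show "(Mt * ?X) $$ (k, i) = (Nt * ?X * mat_diag m (\<lambda>i. D (n + i))) $$ (k, i)"
        using pencil[OF idx[OF ki(2)] ki(1)] by (simp only: mult.commute)
    qed (simp_all add: Mt Nt mat_diag_def)
    moreover have "D (n + i) \<le> D (n + j)" if "i \<le> j" "j < m" for i j
      using that by (intro mono idx) auto
    ultimately have "pencil_eigenvalues Mt Nt = map (\<lambda>i. D (n + i)) [0..<m]"
      by (intro pencil_eigenvalues_diagonalized[OF Mt_carrier Nt_carrier _ det _ _ reg]) auto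
    \<comment> \<open>Eigenvalue number \<open>i - n + 1\<close> sits at list position
      \<open>i - n\<close>, since lists are indexed from 0.\<close>
    moreover have "i - n < m" "n + (i - n) = i"
      using i m by auto
    ultimately show ?thesis
      by (simp add: is_kth_pencil_eigenvalue_def)
  qed

  have eigenvector: "pencil_eigenvector Mt Nt (D i) (Matrix.vec m (\<lambda>j. s (n + j) i))" if i: "i \<in> ?I" for i
  proof -
    let ?\<sigma> = "Matrix.vec m (\<lambda>j. s (n + j) i)"
    have "?\<sigma> \<noteq> 0\<^sub>v m"
    proof
      assume "?\<sigma> = 0\<^sub>v m"
      then have "s (n + j) i = 0" if "j < m" for j
        using that by (metis index_vec index_zero_vec(1))
      then have "AE z in lebesgue_on T0. ut i z = 0"
        using s[OF i] by (simp add: shift)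
      then show False
        using lin_indep_ae_nonzero[OF ut_indep _ i] by simp
    qed
    moreover have "Mt *\<^sub>v ?\<sigma> = D i \<cdot>\<^sub>v (Nt *\<^sub>v ?\<sigma>)"
    proof (rule eq_vecI)
      fix k assume "k < dim_vec (D i \<cdot>\<^sub>v (Nt *\<^sub>v ?\<sigma>))"
      then have "k < m"
        by (simp add: Nt)
      then show "vec_index (Mt *\<^sub>v ?\<sigma>) k = vec_index (D i \<cdot>\<^sub>v (Nt *\<^sub>v ?\<sigma>)) k"
        using pencil[OF i, of k] by (simp add: Mt Nt scalar_prod_def lessThan_atLeast0)
    qed (simp add: Mt Nt)
    ultimately show ?thesis
      by (simp add: pencil_eigenvector_def Mt)
  qed

  show ?thesis
    using mono kth det ut_Et s eigenvector by blast
qed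

end
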